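(* Let $M_0$ be a smooth manifold. Any Lie algebroid structure on $T^*M_0$ compatible with the standard Lie algebroid structure on $TM_0$ (in the sense that $(TM_0,T^*M_0)$ is a Lie bialgebroid) comes from a Poisson structure on $M_0$.
   Context: The standard Lie algebroid structure on $TM_0$ has identity anchor and the commutator bracket of vector fields; the induced bracket on $\Gamma(\wedge^{\cdot}TM_0)$ is the Schouten bracket $[\cdot,\cdot]$. A Lie algebroid structure on $T^*M_0$ is equivalent to a derivation $d_*$ of $\Gamma(\wedge^{\cdot}TM_0)$ of degree $+1$ with $d_*^2=0$ (its Chevalley–Eilenberg type differential). The pair $(TM_0,T^*M_0)$ is a Lie bialgebroid if $d_*[X,Y]=[d_*X,Y]+[X,d_*Y]$ for all vector fields $X,Y$ on $M_0$. A Poisson structure is a bivector field $\pi\in\Gamma(\wedge^2TM_0)$ with $[\pi,\pi]=0$; the Lie algebroid structure on $T^*M_0$ coming from $\pi$ is the one with $d_*=[\pi,\cdot]$ (up to an overall sign convention, which may be absorbed in $\pi$), equivalently the one with anchor $\pi^\#:T^*M_0\to TM_0$, $\pi^\#\alpha=\pi(\alpha,\cdot)$, and bracket $[\alpha,\beta]_\pi=\mathcal{L}_{\pi^\#\alpha}\beta-\mathcal{L}_{\pi^\#\beta}\alpha-d(\pi(\alpha,\beta))$.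
   Formalization: If dim M_0 = 1, it is also assumed that 0 = [d_*f,g] − [f,d_*g] for all functions f, g; without this the claim fails, e.g. on the real line with anchor dx ↦ d/dx, since there ∧²TM_0 = 0 makes compatibility vacuous. Nothing is added in other dimensions. *)

theory Defs
  imports "HOL-Analysis.Analysis"
begin

section \<open>Smooth manifolds\<close>

text \<open>For \<^term>\<open>S\<close> open and a finite-dimensional domain this is the usual notion of a function of
  class $C^k$ on \<^term>\<open>S\<close>.\<close>

primrec Ck_on :: "nat \<Rightarrow> 'e::real_normed_vector set \<Rightarrow> ('e \<Rightarrow> 'f::real_normed_vector) \<Rightarrow> bool" where
  "Ck_on 0 S f \<longleftrightarrow> continuous_on S f"
| "Ck_on (Suc k) S f \<longleftrightarrow> (\<forall>x\<in>S. f differentiable (at x)) \<and>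
     (\<forall>v. Ck_on k S (\<lambda>x. frechet_derivative f (at x) v))"

definition smooth_on :: "'e::real_normed_vector set \<Rightarrow> ('e \<Rightarrow> 'f::real_normed_vector) \<Rightarrow> bool" where
  "smooth_on S f \<longleftrightarrow> (\<forall>k. Ck_on k S f)"

text \<open>An atlas is a set of pairs (domain, coordinate map); it need not be maximal. The manifold is
  the whole type \<^typ>\<open>'a\<close>, and its dimension is that of the model space \<^typ>\<open>'e\<close>. The model space
  is a finite-dimensional inner product space rather than a \<^class>\<open>euclidean_space\<close>, because the
  latter class excludes dimension 0. Completeness is automatic in finite dimension, so the sort
  \<^class>\<open>banach\<close> is no restriction.\<close>

type_synonym ('a, 'e) atlas = "('a set \<times> ('a \<Rightarrow> 'e)) set"

definition smooth_manifold ::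
    "('a::{t2_space,second_countable_topology}, 'e::{real_inner,banach}) atlas \<Rightarrow> bool" where
  "smooth_manifold A \<longleftrightarrow>
     (\<exists>B::'e set. finite B \<and> span B = UNIV) \<and>
     (\<Union>(U, \<phi>)\<in>A. U) = UNIV \<and>
     (\<forall>(U, \<phi>)\<in>A. open U \<and> open (\<phi> ` U) \<and> homeomorphism U (\<phi> ` U) \<phi> (inv_into U \<phi>)) \<and>
     (\<forall>(U, \<phi>)\<in>A. \<forall>(V, \<psi>)\<in>A. smooth_on (\<phi> ` (U \<inter> V)) (\<psi> \<circ> inv_into U \<phi>))"

definition smooth_fun :: "('a, 'e::real_normed_vector) atlas \<Rightarrow> ('a \<Rightarrow> real) set" where
  "smooth_fun A = {f. \<forall>(U, \<phi>)\<in>A. smooth_on (\<phi> ` U) (f \<circ> inv_into U \<phi>)}"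


section \<open>Tangent and cotangent vectors, vector fields and 1-forms\<close>

text \<open>Tangent vectors at \<^term>\<open>p\<close> are the derivations at \<^term>\<open>p\<close> of the algebra of smooth functions.
  Here and below, maps are extended by 0 outside their intended domain, so that equality in HOL is
  equality of the objects in question.\<close>

type_synonym 'a tvec = "('a \<Rightarrow> real) \<Rightarrow> real"
type_synonym 'a covec = "'a tvec \<Rightarrow> real"

definition tangent_space :: "('a, 'e::real_normed_vector) atlas \<Rightarrow> 'a \<Rightarrow> 'a tvec set" where
  "tangent_space A p = {v.
     (\<forall>f\<in>smooth_fun A. \<forall>g\<in>smooth_fun A.
        (\<forall>a b. v (\<lambda>x. a * f x + b * g x) = a * v f + b * v g) \<and>
        v (\<lambda>x. f x * g x) = f p * v g + v f * g p) \<and>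
     (\<forall>f. f \<notin> smooth_fun A \<longrightarrow> v f = 0)}"

definition cotangent_space :: "('a, 'e::real_normed_vector) atlas \<Rightarrow> 'a \<Rightarrow> 'a covec set" where
  "cotangent_space A p = {\<omega>.
     (\<forall>u\<in>tangent_space A p. \<forall>v\<in>tangent_space A p. \<forall>a b.
        \<omega> (\<lambda>f. a * u f + b * v f) = a * \<omega> u + b * \<omega> v) \<and>
     (\<forall>v. v \<notin> tangent_space A p \<longrightarrow> \<omega> v = 0)}"

definition vector_fields :: "('a, 'e::real_normed_vector) atlas \<Rightarrow> ('a \<Rightarrow> 'a tvec) set" where
  "vector_fields A = {X. (\<forall>p. X p \<in> tangent_space A p) \<and>
     (\<forall>f\<in>smooth_fun A. (\<lambda>p. X p f) \<in> smooth_fun A)}"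

definition one_forms :: "('a, 'e::real_normed_vector) atlas \<Rightarrow> ('a \<Rightarrow> 'a covec) set" where
  "one_forms A = {\<alpha>. (\<forall>p. \<alpha> p \<in> cotangent_space A p) \<and>
     (\<forall>X\<in>vector_fields A. (\<lambda>p. \<alpha> p (X p)) \<in> smooth_fun A)}"

definition differential ::
    "('a, 'e::real_normed_vector) atlas \<Rightarrow> ('a \<Rightarrow> real) \<Rightarrow> 'a \<Rightarrow> 'a covec" where
  "differential A f p v = (if v \<in> tangent_space A p then v f else 0)"

definition lie_bracket :: "('a \<Rightarrow> 'a tvec) \<Rightarrow> ('a \<Rightarrow> 'a tvec) \<Rightarrow> 'a \<Rightarrow> 'a tvec" where
  "lie_bracket X Y p f = X p (\<lambda>q. Y q f) - Y p (\<lambda>q. X q f)"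

text \<open>The Lie derivative of the 1-form \<^term>\<open>\<beta>\<close> along \<^term>\<open>X\<close>, given by
  $({\cal L}_X\beta)(Y) = X(\beta(Y)) - \beta([X,Y])$. The value at \<^term>\<open>p\<close> depends only on
  the vector $Y_p$, not on the vector field $Y$ chosen to extend it.\<close>

definition lie_derivative :: "('a, 'e::real_normed_vector) atlas \<Rightarrow> ('a \<Rightarrow> 'a tvec) \<Rightarrow>
    ('a \<Rightarrow> 'a covec) \<Rightarrow> 'a \<Rightarrow> 'a covec" where
  "lie_derivative A X \<beta> p v =
     (if v \<in> tangent_space A p
      then let Y = (SOME Y. Y \<in> vector_fields A \<and> Y p = v)
           in X p (\<lambda>q. \<beta> q (Y q)) - \<beta> p (lie_bracket X Y p)
      else 0)"


section \<open>Multivector fields and the Schouten bracket\<close>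

text \<open>In the same way as a tangent vector is a derivation at \<^term>\<open>p\<close>, an element of $\wedge^k T_pM$ is
  an alternating map of \<^term>\<open>k\<close> smooth functions which is a derivation at \<^term>\<open>p\<close> in each argument;
  $P(f_1,\dots,f_k)$ is the value of $P$ on $df_1,\dots,df_k$, with the normalisation
  $(X\wedge Y)(f,g) = X(f)Y(g) - Y(f)X(g)$. The arguments are kept in a list.\<close>

type_synonym 'a mvec = "('a \<Rightarrow> real) list \<Rightarrow> real"

definition multitangent_space ::
    "('a, 'e::real_normed_vector) atlas \<Rightarrow> nat \<Rightarrow> 'a \<Rightarrow> 'a mvec set" where
  "multitangent_space A k p = {P.
     (\<forall>fs. length fs = k \<and> set fs \<subseteq> smooth_fun A \<longrightarrow>
        (\<forall>i<k. (\<lambda>f. P (fs[i := f])) \<in> tangent_space A p) \<and>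
        (\<forall>i<k. \<forall>j<k. i \<noteq> j \<and> fs ! i = fs ! j \<longrightarrow> P fs = 0)) \<and>
     (\<forall>fs. \<not> (length fs = k \<and> set fs \<subseteq> smooth_fun A) \<longrightarrow> P fs = 0)}"

definition multivector_fields ::
    "('a, 'e::real_normed_vector) atlas \<Rightarrow> nat \<Rightarrow> ('a \<Rightarrow> 'a mvec) set" where
  "multivector_fields A k = {P. (\<forall>p. P p \<in> multitangent_space A k p) \<and>
     (\<forall>fs. length fs = k \<and> set fs \<subseteq> smooth_fun A \<longrightarrow> (\<lambda>p. P p fs) \<in> smooth_fun A)}"

text \<open>Functions and vector fields as multivector fields of degree 0 and 1.\<close>

definition mv_fun :: "('a \<Rightarrow> real) \<Rightarrow> 'a \<Rightarrow> 'a mvec" where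
  "mv_fun f p fs = (if fs = [] then f p else 0)"

definition mv_field :: "('a \<Rightarrow> 'a tvec) \<Rightarrow> 'a \<Rightarrow> 'a mvec" where
  "mv_field X p fs = (if length fs = 1 then X p (hd fs) else 0)"

text \<open>For $P$ of degree $a$ and $Q$ of degree $b$, the alternating sum over $(a-1,b)$-shuffles
  $\sigma$ of
  $P(f_{\sigma(1)},\dots,f_{\sigma(a-1)},Q(f_{\sigma(a)},\dots,f_{\sigma(a+b-1)}))$, written as a
  normalised sum over all permutations (indices start at 0 below). It vanishes for
  \<^term>\<open>a = 0\<close>, because then $P$ is applied to a nonempty list.\<close>

definition mv_insert ::
    "nat \<Rightarrow> nat \<Rightarrow> ('a \<Rightarrow> 'a mvec) \<Rightarrow> ('a \<Rightarrow> 'a mvec) \<Rightarrow> 'a \<Rightarrow> 'a mvec" where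
  "mv_insert a b P Q p fs =
     (\<Sum>\<sigma> | \<sigma> permutes {..<a + b - 1}. of_int (sign \<sigma>) *
        P p (map (\<lambda>i. fs ! \<sigma> i) [0..<a - 1] @
             [\<lambda>q. Q q (map (\<lambda>i. fs ! \<sigma> i) [a - 1..<a + b - 1])]))
     / (fact (a - 1) * fact b)"

text \<open>The bracket of $P$ of degree $a$ and $Q$ of degree $b$. This is the extension of the commutator
  bracket with $[X,f] = X(f)$ and $[P,Q\wedge R] = [P,Q]\wedge R + (-1)^{(a-1)b}\, Q\wedge[P,R]$. The
  exponent \<^term>\<open>(a + 1) * (b + 1)\<close> has the parity of $(a-1)(b-1)$ and avoids truncated
  subtraction.\<close>

definition schouten ::
    "nat \<Rightarrow> nat \<Rightarrow> ('a \<Rightarrow> 'a mvec) \<Rightarrow> ('a \<Rightarrow> 'a mvec) \<Rightarrow> 'a \<Rightarrow> 'a mvec" where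
  "schouten a b P Q p fs =
     (if length fs + 1 = a + b
      then mv_insert a b P Q p fs - (- 1) ^ ((a + 1) * (b + 1)) * mv_insert b a Q P p fs
      else 0)"


section \<open>Lie algebroid structures on the cotangent bundle\<close>

text \<open>A Lie algebroid structure on $T^*M$: the bracket \<^term>\<open>br\<close> on 1-forms and the anchor
  \<^term>\<open>\<rho>\<close>, a bundle map from $T^*M$ to $TM$.\<close>

definition cotangent_lie_algebroid :: "('a, 'e::real_normed_vector) atlas \<Rightarrow>
    (('a \<Rightarrow> 'a covec) \<Rightarrow> ('a \<Rightarrow> 'a covec) \<Rightarrow> ('a \<Rightarrow> 'a covec)) \<Rightarrow>
    ('a \<Rightarrow> 'a covec \<Rightarrow> 'a tvec) \<Rightarrow> bool" where
  "cotangent_lie_algebroid A br \<rho> \<longleftrightarrow>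
     \<comment> \<open>smooth bundle map over the identity\<close>
     (\<forall>p. \<forall>\<omega>\<in>cotangent_space A p. \<rho> p \<omega> \<in> tangent_space A p) \<and>
     (\<forall>p. \<forall>\<omega>\<in>cotangent_space A p. \<forall>\<eta>\<in>cotangent_space A p. \<forall>a b.
        \<rho> p (\<lambda>v. a * \<omega> v + b * \<eta> v) = (\<lambda>f. a * \<rho> p \<omega> f + b * \<rho> p \<eta> f)) \<and>
     (\<forall>\<alpha>\<in>one_forms A. (\<lambda>p. \<rho> p (\<alpha> p)) \<in> vector_fields A) \<and>
     \<comment> \<open>real Lie algebra\<close>
     (\<forall>\<alpha>\<in>one_forms A. \<forall>\<beta>\<in>one_forms A. br \<alpha> \<beta> \<in> one_forms A) \<and>
     (\<forall>\<alpha>\<in>one_forms A. \<forall>\<beta>\<in>one_forms A. \<forall>\<gamma>\<in>one_forms A. \<forall>a b.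
        br (\<lambda>p v. a * \<alpha> p v + b * \<beta> p v) \<gamma> = (\<lambda>p v. a * br \<alpha> \<gamma> p v + b * br \<beta> \<gamma> p v)) \<and>
     (\<forall>\<alpha>\<in>one_forms A. \<forall>\<beta>\<in>one_forms A. br \<alpha> \<beta> = (\<lambda>p v. - br \<beta> \<alpha> p v)) \<and>
     (\<forall>\<alpha>\<in>one_forms A. \<forall>\<beta>\<in>one_forms A. \<forall>\<gamma>\<in>one_forms A. \<forall>p v.
        br \<alpha> (br \<beta> \<gamma>) p v + br \<beta> (br \<gamma> \<alpha>) p v + br \<gamma> (br \<alpha> \<beta>) p v = 0) \<and>
     \<comment> \<open>anchor and Leibniz rule\<close>
     (\<forall>\<alpha>\<in>one_forms A. \<forall>\<beta>\<in>one_forms A.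
        (\<lambda>p. \<rho> p (br \<alpha> \<beta> p)) = lie_bracket (\<lambda>p. \<rho> p (\<alpha> p)) (\<lambda>p. \<rho> p (\<beta> p))) \<and>
     (\<forall>\<alpha>\<in>one_forms A. \<forall>\<beta>\<in>one_forms A. \<forall>f\<in>smooth_fun A.
        br \<alpha> (\<lambda>p v. f p * \<beta> p v) = (\<lambda>p v. f p * br \<alpha> \<beta> p v + \<rho> p (\<alpha> p) f * \<beta> p v))"

definition drop_index :: "nat \<Rightarrow> 'b list \<Rightarrow> 'b list" where
  "drop_index i xs = take i xs @ drop (Suc i) xs"

text \<open>The Chevalley--Eilenberg differential $d_*$ of a multivector field $P$ of degree \<^term>\<open>k\<close>, i.e.
  \[ (d_*P)(\alpha_0,\dots,\alpha_k) =
       \sum_i (-1)^i \rho(\alpha_i)\bigl(P(\dots,\widehat{\alpha_i},\dots)\bigr)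
     + \sum_{i<j} (-1)^{i+j}
         P([\alpha_i,\alpha_j],\dots,\widehat{\alpha_i},\dots,\widehat{\alpha_j},\dots), \]
  evaluated on $\alpha_i = df_i$. For a covector $\omega$ at \<^term>\<open>p\<close>, the value
  $P(\omega,dg_2,\dots,dg_k)$ is $\omega$ applied to the tangent vector
  $f \mapsto P(f,g_2,\dots,g_k)$.\<close>

definition ce_differential :: "('a, 'e::real_normed_vector) atlas \<Rightarrow>
    (('a \<Rightarrow> 'a covec) \<Rightarrow> ('a \<Rightarrow> 'a covec) \<Rightarrow> ('a \<Rightarrow> 'a covec)) \<Rightarrow>
    ('a \<Rightarrow> 'a covec \<Rightarrow> 'a tvec) \<Rightarrow> nat \<Rightarrow> ('a \<Rightarrow> 'a mvec) \<Rightarrow> 'a \<Rightarrow> 'a mvec" where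
  "ce_differential A br \<rho> k P p fs =
     (if length fs = Suc k \<and> set fs \<subseteq> smooth_fun A then
        (\<Sum>i<Suc k. (- 1) ^ i *
           \<rho> p (differential A (fs ! i) p) (\<lambda>q. P q (drop_index i fs))) +
        (\<Sum>j<Suc k. \<Sum>i<j. (- 1) ^ (i + j) *
           br (differential A (fs ! i)) (differential A (fs ! j)) p
              (\<lambda>f. P p (f # drop_index i (drop_index j fs))))
      else 0)"

text \<open>The pair $(TM, T^*M)$ is a Lie bialgebroid:
  $d_*[X,Y] = [d_*X,Y] + [X,d_*Y]$ for all vector fields.\<close>

definition lie_bialgebroid :: "('a, 'e::real_normed_vector) atlas \<Rightarrow>
    (('a \<Rightarrow> 'a covec) \<Rightarrow> ('a \<Rightarrow> 'a covec) \<Rightarrow> ('a \<Rightarrow> 'a covec)) \<Rightarrow>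
    ('a \<Rightarrow> 'a covec \<Rightarrow> 'a tvec) \<Rightarrow> bool" where
  "lie_bialgebroid A br \<rho> \<longleftrightarrow> cotangent_lie_algebroid A br \<rho> \<and>
     (\<forall>X\<in>vector_fields A. \<forall>Y\<in>vector_fields A.
        ce_differential A br \<rho> 1 (mv_field (lie_bracket X Y)) =
        (\<lambda>p fs. schouten 2 1 (ce_differential A br \<rho> 1 (mv_field X)) (mv_field Y) p fs +
                schouten 1 2 (mv_field X) (ce_differential A br \<rho> 1 (mv_field Y)) p fs))"

text \<open>The same compatibility for functions, where $[f,g] = 0$:
  $0 = [d_*f,g] - [f,d_*g]$. If $\dim M \ne 1$, it follows from \<^term>\<open>lie_bialgebroid\<close>. On a
  1-manifold it does not: there $\wedge^2 TM = 0$, so that \<^term>\<open>lie_bialgebroid\<close> holds for every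
  Lie algebroid structure on $T^*M$, whereas 0 is the only bivector field.\<close>

definition compatible_on_functions :: "('a, 'e::real_normed_vector) atlas \<Rightarrow>
    (('a \<Rightarrow> 'a covec) \<Rightarrow> ('a \<Rightarrow> 'a covec) \<Rightarrow> ('a \<Rightarrow> 'a covec)) \<Rightarrow>
    ('a \<Rightarrow> 'a covec \<Rightarrow> 'a tvec) \<Rightarrow> bool" where
  "compatible_on_functions A br \<rho> \<longleftrightarrow>
     (\<forall>f\<in>smooth_fun A. \<forall>g\<in>smooth_fun A. \<forall>p fs.
        schouten 1 0 (ce_differential A br \<rho> 0 (mv_fun f)) (mv_fun g) p fs -
        schouten 0 1 (mv_fun f) (ce_differential A br \<rho> 0 (mv_fun g)) p fs = 0)"


section \<open>Poisson structures\<close>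

definition poisson_structure ::
    "('a, 'e::real_normed_vector) atlas \<Rightarrow> ('a \<Rightarrow> 'a mvec) \<Rightarrow> bool" where
  "poisson_structure A \<pi> \<longleftrightarrow>
     \<pi> \<in> multivector_fields A 2 \<and> schouten 2 2 \<pi> \<pi> = (\<lambda>p fs. 0)"

text \<open>$\pi^\#\omega = \pi(\omega,\cdot)$, a tangent vector at \<^term>\<open>p\<close>.\<close>

definition sharp :: "('a \<Rightarrow> 'a mvec) \<Rightarrow> 'a \<Rightarrow> 'a covec \<Rightarrow> 'a tvec" where
  "sharp \<pi> p \<omega> = (\<lambda>g. \<omega> (\<lambda>f. \<pi> p [f, g]))"

text \<open>$[\alpha,\beta]_\pi = {\cal L}_{\pi^\#\alpha}\beta - {\cal L}_{\pi^\#\beta}\alpha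
  - d(\pi(\alpha,\beta))$, where $\pi(\alpha,\beta) = \beta(\pi^\#\alpha)$.\<close>

definition poisson_bracket :: "('a, 'e::real_normed_vector) atlas \<Rightarrow> ('a \<Rightarrow> 'a mvec) \<Rightarrow>
    ('a \<Rightarrow> 'a covec) \<Rightarrow> ('a \<Rightarrow> 'a covec) \<Rightarrow> 'a \<Rightarrow> 'a covec" where
  "poisson_bracket A \<pi> \<alpha> \<beta> p v =
     lie_derivative A (\<lambda>q. sharp \<pi> q (\<alpha> q)) \<beta> p v
     - lie_derivative A (\<lambda>q. sharp \<pi> q (\<beta> q)) \<alpha> p v
     - differential A (\<lambda>q. \<beta> q (sharp \<pi> q (\<alpha> q))) p v"

definition comes_from_poisson :: "('a, 'e::real_normed_vector) atlas \<Rightarrow>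
    (('a \<Rightarrow> 'a covec) \<Rightarrow> ('a \<Rightarrow> 'a covec) \<Rightarrow> ('a \<Rightarrow> 'a covec)) \<Rightarrow>
    ('a \<Rightarrow> 'a covec \<Rightarrow> 'a tvec) \<Rightarrow> ('a \<Rightarrow> 'a mvec) \<Rightarrow> bool" where
  "comes_from_poisson A br \<rho> \<pi> \<longleftrightarrow>
     (\<forall>p. \<forall>\<omega>\<in>cotangent_space A p. \<rho> p \<omega> = sharp \<pi> p \<omega>) \<and>
     (\<forall>\<alpha>\<in>one_forms A. \<forall>\<beta>\<in>one_forms A. br \<alpha> \<beta> = poisson_bracket A \<pi> \<alpha> \<beta>)"

end

theory Submission
  imports Defs
begin

text \<open>Put $\{f,g\} = \rho(df)g$. Comparing the compatibility condition for $X, hY$ with that for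
  $X, Y$ gives $W\wedge Y = 0$ for all $Y$, where
  $W(f) = \{h,Xf\} + \{Xf,h\} + [df,dh]_*(X) - X\{f,h\}$. If the dimension is not 1, then $W = 0$;
  since all but the first two terms are linear over the functions in $X$, replacing $X$ by $uX$ shows
  that the bracket of functions is skew, and then $[df,dh]_* = d\{f,h\}$. In dimension 1 the bracket is
  skew by the compatibility on functions, hence zero; so the anchor vanishes and the bracket of forms,
  being bilinear over the functions and skew on a line bundle, vanishes too. Thus $\{\cdot,\cdot\}$ is a
  Poisson bracket, and $[\cdot,\cdot]_*$ agrees with $[\cdot,\cdot]_\pi$ on exact forms. Both satisfy
  the same Leibniz rule, so their difference is tensorial and vanishes. The link between derivations and
  smooth charts needed here is the existence of local frames, from Hadamard's lemma and bump
  functions.\<close>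


section \<open>Functions of class $C^k$\<close>

text \<open>Tangent vectors are derivations of the algebra of global smooth functions, and the
  bracket acts on global forms only, so nothing may simply be restricted to a chart. The frames are
  therefore cut off to global objects, and what gets expanded is \<eta> \<alpha> instead of
  \<alpha>. As \<eta> p = 1, a map that is function-linear at p takes the same value on both, which
  replaces a separate locality argument.

  The relation W \<and> Y = 0 reads W(f) Y(g) = W(g) Y(f). It forces W(f) = 0 as soon as some Y
  kills f at p without vanishing there; this takes two independent directions, and hence dimension 1
  is the exception (in dimension 0 everything vanishes). Replacing X by uX yields skewness because
  the derivation rules applied to {h, u Xf} + {u Xf, h} leave the extra term X(f) ({h,u} + {u,h}).

  Skewness has to precede the comparison of brackets: the Leibniz rule of the bracket defined by
  \<pi> holds only because two terms with Y(u) cancel by skewness of the anchor. The Jacobi identity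
  of the bracket of functions is the compatibility of the anchor with brackets, read on df and
  dg.\<close>

lemma has_derivative_imp_frechet:
  "(f has_derivative f') (at x) \<Longrightarrow> frechet_derivative f (at x) = f'"
  by (metis frechet_derivative_at)

lemma Ck_on_cong:
  assumes "open S" "\<And>x. x \<in> S \<Longrightarrow> f x = g x" "Ck_on k S f"
  shows "Ck_on k S g"
  using assms(2,3)
proof (induction k arbitrary: f g)
  case 0
  then show ?case by (metis Ck_on.simps(1) continuous_on_cong)
next
  case (Suc k)
  have d: "(g has_derivative frechet_derivative f (at x)) (at x)" if "x \<in> S" for x
    using Suc.prems that assms(1)
    by (metis Ck_on.simps(2) frechet_derivative_works has_derivative_transform_within_open)
  then have "frechet_derivative f (at x) = frechet_derivative g (at x)" if "x \<in> S" for x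
    using that by (metis has_derivative_imp_frechet)
  with Suc.IH Suc.prems(2) have "Ck_on k S (\<lambda>x. frechet_derivative g (at x) v)" for v
    by (metis (no_types, lifting) Ck_on.simps(2))
  with d show ?case by (auto simp: differentiable_def)
qed

lemma Ck_on_subset: "Ck_on k T f \<Longrightarrow> S \<subseteq> T \<Longrightarrow> Ck_on k S f"
  by (induction k arbitrary: f) (auto intro: continuous_on_subset)

lemma Ck_on_Un:
  assumes "open S" "open T" "Ck_on k S f" "Ck_on k T f"
  shows "Ck_on k (S \<union> T) f"
  using assms(3,4)
  by (induction k arbitrary: f) (auto intro: continuous_on_open_Un assms)

text \<open>Any explicit derivative may stand in for \<open>frechet_derivative\<close>, by
  uniqueness of derivatives; \<open>Ck_on_cong\<close> carries the agreement on the open set S to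
  the remaining orders.\<close>

lemma Ck_on_SucI:
  assumes "open S" "\<And>x. x \<in> S \<Longrightarrow> (f has_derivative f' x) (at x)"
    and "\<And>v. Ck_on k S (\<lambda>x. f' x v)"
  shows "Ck_on (Suc k) S f"
proof -
  have "f' x = frechet_derivative f (at x)" if "x \<in> S" for x
    using assms(2) that has_derivative_imp_frechet by metis
  then have "Ck_on k S (\<lambda>x. frechet_derivative f (at x) v)" for v
    by (intro Ck_on_cong[OF assms(1) _ assms(3)[of v]]) simp
  with assms(2) show ?thesis by (auto simp: differentiable_def)
qed

lemma Ck_on_SucD:
  assumes "Ck_on (Suc k) S f" "x \<in> S"
  shows "(f has_derivative frechet_derivative f (at x)) (at x)"
  using assms frechet_derivative_works by auto

lemma Ck_on_lower: "Ck_on (Suc k) S f \<Longrightarrow> Ck_on k S f"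
proof (induction k arbitrary: f)
  case 0
  then show ?case
    by (auto intro!: differentiable_imp_continuous_on differentiable_at_imp_differentiable_on)
qed auto

lemma Ck_on_const: "Ck_on k S (\<lambda>x. c)"
  by (induction k arbitrary: c) (simp_all add: frechet_derivative_const)

lemma Ck_on_add:
  assumes "open S" "Ck_on k S f" "Ck_on k S g"
  shows "Ck_on k S (\<lambda>x. f x + g x)"
  using assms(2,3)
proof (induction k arbitrary: f g)
  case (Suc k)
  show ?case
    by (rule Ck_on_SucI[OF assms(1) has_derivative_add[OF Ck_on_SucD Ck_on_SucD]])
      (use Suc in auto)
qed (auto intro: continuous_intros)

lemma Ck_on_bounded_linear:
  assumes "open S" "bounded_linear h" "Ck_on k S f"
  shows "Ck_on k S (\<lambda>x. h (f x))"
  using assms(3)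
proof (induction k arbitrary: f)
  case 0
  then show ?case by (simp add: assms(2) bounded_linear.continuous_on)
next
  case (Suc k)
  show ?case
    by (rule Ck_on_SucI[OF assms(1) bounded_linear.has_derivative[OF assms(2) Ck_on_SucD]])
      (use Suc in auto)
qed

lemma Ck_on_mult:
  fixes f g :: "'e::real_normed_vector \<Rightarrow> real"
  assumes "open S" "Ck_on k S f" "Ck_on k S g"
  shows "Ck_on k S (\<lambda>x. f x * g x)"
  using assms(2,3)
proof (induction k arbitrary: f g)
  case (Suc k)
  show ?case
  proof (rule Ck_on_SucI[OF assms(1) has_derivative_mult[OF Ck_on_SucD Ck_on_SucD]])
    show "Ck_on k S (\<lambda>x. f x * frechet_derivative g (at x) v + frechet_derivative f (at x) v * g x)" for v
      by (intro Ck_on_add assms(1) Suc.IH) (use Suc.prems Ck_on_lower in auto)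
  qed (use Suc in auto)
qed (auto intro: continuous_intros)

lemma Ck_on_sum:
  assumes "open S" "\<And>i. i \<in> I \<Longrightarrow> Ck_on k S (f i)"
  shows "Ck_on k S (\<lambda>x. \<Sum>i\<in>I. f i x)"
  using assms(2) by (induction I rule: infinite_finite_induct) (auto intro: Ck_on_const Ck_on_add assms(1))

lemma Ck_on_id: "open S \<Longrightarrow> Ck_on k S (\<lambda>x. x)"
proof (cases k)
  case (Suc n)
  assume "open S"
  then show ?thesis
    unfolding Suc by (rule Ck_on_SucI[OF _ has_derivative_ident]) (rule Ck_on_const)
qed (simp add: continuous_on_id)

lemma Ck_on_linear: "open S \<Longrightarrow> bounded_linear h \<Longrightarrow> Ck_on k S h"
  using Ck_on_bounded_linear Ck_on_id by blast

text \<open>In the chain rule both the point and the direction of the derivative of g vary with x.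
  Expanding the direction in the finite basis B leaves sums of products in which g is differentiated
  in fixed directions b, and the induction hypothesis, general in g, applies to these.\<close>

lemma Ck_on_compose:
  fixes g :: "'e::real_inner \<Rightarrow> real" and f :: "'d::real_normed_vector \<Rightarrow> 'e"
  assumes B: "\<And>z::'e. z = (\<Sum>b\<in>B. (z \<bullet> b) *\<^sub>R b)"
    and S: "open S" and T: "open T" and fST: "f ` S \<subseteq> T"
    and f: "Ck_on k S f" and g: "Ck_on k T g"
  shows "Ck_on k S (\<lambda>x. g (f x))"
  using f g
proof (induction k arbitrary: g)
  case 0
  then show ?case using fST by (auto intro: continuous_on_compose2)
next
  case (Suc k)
  let ?D = "\<lambda>x v. frechet_derivative g (at (f x)) (frechet_derivative f (at x) v)"
  have gd: "(g has_derivative frechet_derivative g (at (f x))) (at (f x))" if "x \<in> S" for x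
    using Ck_on_SucD[OF Suc.prems(2)] fST that by blast
  have D: "((\<lambda>x. g (f x)) has_derivative ?D x) (at x)" if "x \<in> S" for x
    by (rule has_derivative_compose[OF Ck_on_SucD[OF Suc.prems(1) that] gd[OF that]])
  show ?case
  proof (rule Ck_on_SucI[OF S D])
    fix v
    have lin: "linear (frechet_derivative g (at (f x)))" if "x \<in> S" for x
      using gd[OF that] has_derivative_linear by blast
    have eq: "(\<Sum>b\<in>B. (frechet_derivative f (at x) v \<bullet> b) * frechet_derivative g (at (f x)) b) = ?D x v"
      if "x \<in> S" for x
      by (subst (2) B[of "frechet_derivative f (at x) v"])
        (simp add: linear_sum[OF lin[OF that]] linear_cmul[OF lin[OF that]])
    have "Ck_on k S (\<lambda>x. \<Sum>b\<in>B. (frechet_derivative f (at x) v \<bullet> b) * frechet_derivative g (at (f x)) b)"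
    proof (intro Ck_on_sum[OF S] Ck_on_mult[OF S])
      fix b
      show "Ck_on k S (\<lambda>x. frechet_derivative f (at x) v \<bullet> b)"
        using Suc.prems(1) by (intro Ck_on_bounded_linear[OF S bounded_linear_inner_left]) simp
      show "Ck_on k S (\<lambda>x. frechet_derivative g (at (f x)) b)"
        by (rule Suc.IH[of "\<lambda>y. frechet_derivative g (at y) b", OF Ck_on_lower[OF Suc.prems(1)]])
          (use Suc.prems(2) in simp)
    qed
    then show "Ck_on k S (\<lambda>x. ?D x v)" by (rule Ck_on_cong[OF S, rotated]) (rule eq)
  qed
qed

lemma Ck_on_real_SucI:
  fixes f :: "real \<Rightarrow> real"
  assumes "open S" "\<And>x. x \<in> S \<Longrightarrow> (f has_real_derivative f' x) (at x)" "Ck_on k S f'"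
  shows "Ck_on (Suc k) S f"
proof (rule Ck_on_SucI[OF assms(1)])
  show "(f has_derivative (\<lambda>v. f' x * v)) (at x)" if "x \<in> S" for x
    using assms(2)[OF that] by (simp add: has_field_derivative_def)
  show "Ck_on k S (\<lambda>x. f' x * v)" for v
    by (intro Ck_on_mult assms Ck_on_const)
qed

lemma Ck_on_inverse: "Ck_on k {x::real. x \<noteq> 0} inverse"
proof (induction k)
  case 0
  then show ?case by (auto intro!: continuous_intros)
next
  case (Suc k)
  have o: "open {x::real. x \<noteq> 0}"
    using open_delete[of UNIV "0::real"] by (simp add: set_diff_eq)
  have D: "(inverse has_real_derivative (- 1) * (inverse x * inverse x)) (at x)"
    if "x \<in> {x::real. x \<noteq> 0}" for x :: real
    using DERIV_inverse[of x] that by (simp add: power2_eq_square)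
  show ?case
    by (rule Ck_on_real_SucI[OF o D Ck_on_mult[OF o Ck_on_const Ck_on_mult[OF o Suc Suc]]])
qed


section \<open>Bump functions\<close>

text \<open>\<open>flat 0\<close> is the standard smooth function that is flat at 0. The powers of
  1/x are included because derivatives of members of this family are combinations of members, so
  smoothness follows by one induction over all n at once.\<close>

definition flat :: "nat \<Rightarrow> real \<Rightarrow> real" where
  "flat n x = (if x \<le> 0 then 0 else inverse x ^ n * exp (- inverse x))"

lemma flat_tendsto: "(flat n \<longlongrightarrow> 0) (at 0)"
proof -
  have "((\<lambda>y::real. y ^ n / exp y) \<longlongrightarrow> 0) at_top"
    by (rule tendsto_power_div_exp_0)
  then have "((\<lambda>x::real. inverse x ^ n / exp (inverse x)) \<longlongrightarrow> 0) (at_right 0)"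
    using filterlim_compose[OF _ filterlim_inverse_at_top_right] by blast
  then have r: "(flat n \<longlongrightarrow> 0) (at_right 0)"
    by (rule Lim_transform_eventually)
      (auto simp: eventually_at_filter flat_def exp_minus divide_inverse)
  have "(flat n \<longlongrightarrow> 0) (at_left 0)"
    by (rule Lim_transform_eventually[OF tendsto_const])
      (auto simp: eventually_at_filter flat_def)
  with r show ?thesis by (simp add: filterlim_split_at)
qed

lemma flat_deriv:
  "(flat n has_real_derivative flat (n + 2) x - real n * flat (n + 1) x) (at x)"
proof (cases x "0::real" rule: linorder_cases)
  case less
  have "(flat n has_real_derivative 0) (at x)"
    by (rule has_field_derivative_transform_within_open[where S = "{..<0}", OF DERIV_const])
      (use less in \<open>auto simp: flat_def\<close>)
  with less show ?thesis by (simp add: flat_def)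
next
  case equal
  \<comment> \<open>The difference quotient of \<open>flat n\<close> at 0 is
    \<open>flat (n + 1)\<close>, which tends to 0.\<close>
  have "((\<lambda>h. (flat n (0 + h) - flat n 0) / h) \<longlongrightarrow> 0) (at 0)"
    by (rule Lim_transform_eventually[OF flat_tendsto[of "n + 1"]])
      (auto simp: flat_def divide_inverse eventually_at_filter)
  with equal show ?thesis
    unfolding DERIV_def by (simp add: flat_def)
next
  case greater
  have p: "((\<lambda>x. inverse x ^ n) has_real_derivative - (real n * inverse x ^ (n + 1))) (at x)"
  proof (cases n)
    case (Suc m)
    show ?thesis
      unfolding Suc by (rule DERIV_cong[OF DERIV_power[OF DERIV_inverse]]) (use greater in auto)
  qed simp
  have e: "((\<lambda>x. exp (- inverse x)) has_real_derivative exp (- inverse x) * inverse x ^ 2) (at x)"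
    by (rule DERIV_cong[OF DERIV_fun_exp[OF DERIV_minus[OF DERIV_inverse]]])
      (use greater in \<open>auto simp: numeral_2_eq_2\<close>)
  have "((\<lambda>x. inverse x ^ n * exp (- inverse x)) has_real_derivative
      flat (n + 2) x - real n * flat (n + 1) x) (at x)"
  proof (rule DERIV_cong[OF DERIV_mult[OF p e]])
    define u where "u = inverse x"
    show "- (real n * inverse x ^ (n + 1)) * exp (- inverse x) + exp (- inverse x) * (inverse x)\<^sup>2 * inverse x ^ n
      = flat (n + 2) x - real n * flat (n + 1) x"
      using greater unfolding flat_def u_def[symmetric] by (simp add: power_add power2_eq_square)
  qed
  then show ?thesis
    by (rule has_field_derivative_transform_within_open[where S = "{0<..}"])
      (use greater in \<open>auto simp: flat_def\<close>)
qed

lemma Ck_on_flat: "Ck_on k UNIV (flat n)"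
proof (induction k arbitrary: n)
  case 0
  have "isCont (flat n) x" for x
    by (rule DERIV_isCont[OF flat_deriv])
  then show ?case by (simp add: continuous_on_eq_continuous_at)
next
  case (Suc k)
  have "Ck_on k UNIV (\<lambda>x. flat (n + 2) x + (- real n) * flat (n + 1) x)"
    by (intro Ck_on_add Ck_on_mult Ck_on_const Suc open_UNIV)
  then show ?case
    using flat_deriv[of n] by (intro Ck_on_real_SucI) auto
qed

text \<open>The function is a / (a + b), where a is positive exactly inside radius R and b exactly
  outside radius r. Since r < R, at every point one of them is positive, so the denominator never
  vanishes. The squared distance \<open>N\<close> is used because the norm is not smooth at the
  centre.\<close>

lemma bump_exists:
  fixes c :: "'e::real_inner"
  assumes "0 < r" "r < R"
  obtains h :: "'e \<Rightarrow> real" where "\<And>k. Ck_on k UNIV h"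
    "\<And>z. dist c z \<le> r \<Longrightarrow> h z = 1" "\<And>z. dist c z \<ge> R \<Longrightarrow> h z = 0"
proof -
  have sq: "r\<^sup>2 < R\<^sup>2" using assms by (simp add: power_strict_mono)
  define N where "N z = (z - c) \<bullet> (z - c)" for z
  have N: "N z = (dist c z)\<^sup>2" for z
    unfolding dist_commute[of c] by (simp add: N_def power2_norm_eq_inner dist_norm)
  have Ndiff: "Ck_on k UNIV N" for k
  proof (cases k)
    case 0
    then show ?thesis by (auto simp: N_def[abs_def] intro!: continuous_intros)
  next
    case (Suc n)
    have D: "(N has_derivative (\<lambda>v. 2 * ((x - c) \<bullet> v))) (at x)" for x
      unfolding N_def[abs_def]
      by (auto intro!: derivative_eq_intros simp: inner_commute)
    show ?thesis unfolding Suc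
    proof (rule Ck_on_SucI[OF open_UNIV D])
      fix v
      have "Ck_on n UNIV (\<lambda>x. 2 * (x \<bullet> v) + - 2 * (c \<bullet> v))"
        by (intro Ck_on_add Ck_on_mult Ck_on_const Ck_on_linear bounded_linear_inner_left open_UNIV)
      then show "Ck_on n UNIV (\<lambda>x. 2 * ((x - c) \<bullet> v))"
        by (simp add: algebra_simps inner_diff_left)
    qed
  qed
  \<comment> \<open>\<open>Ck_on_compose\<close> asks for a basis expansion of the intermediate
    space, here the real line.\<close>
  have real_basis: "(z::real) = (\<Sum>b\<in>{1}. (z \<bullet> b) *\<^sub>R b)" for z by simp
  have comp: "Ck_on k UNIV (\<lambda>z. g (f z))" if "Ck_on k UNIV f" "Ck_on k T g" "open T" "range f \<subseteq> T"
    for g :: "real \<Rightarrow> real" and f :: "'e \<Rightarrow> real" and k T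
    using Ck_on_compose[OF real_basis open_UNIV that(3,4,1,2)] .
  define a where "a z = flat 0 (R\<^sup>2 + - 1 * N z)" for z
  define b where "b z = flat 0 (N z + - (r\<^sup>2))" for z
  have a: "Ck_on k UNIV a" and b: "Ck_on k UNIV b" for k
    unfolding a_def b_def
    by (intro comp[OF _ Ck_on_flat] Ck_on_add Ck_on_mult Ck_on_const Ndiff; simp)+
  have flat_pos: "flat 0 x > 0 \<longleftrightarrow> x > 0" "flat 0 x \<ge> 0" for x
    by (auto simp: flat_def)
  have pos: "a z + b z > 0" for z
  proof (cases "N z < R\<^sup>2")
    case True
    then show ?thesis
      using flat_pos unfolding a_def b_def by (intro add_pos_nonneg) auto
  next
    case False
    then show ?thesis
      using flat_pos sq unfolding a_def b_def by (intro add_nonneg_pos) auto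
  qed
  have o: "open {x::real. x \<noteq> 0}"
    using open_delete[of UNIV "0::real"] by (simp add: set_diff_eq)
  show ?thesis
  proof
    show "Ck_on k UNIV (\<lambda>z. a z * inverse (a z + b z))" for k
      by (intro Ck_on_mult a comp[OF _ Ck_on_inverse o] Ck_on_add b open_UNIV)
        (use pos in \<open>auto simp: less_imp_neq[symmetric]\<close>)
    show "a z * inverse (a z + b z) = 1" if "dist c z \<le> r" for z
    proof -
      have "N z \<le> r\<^sup>2" using that by (simp add: N power_mono)
      then have "b z = 0" by (simp add: b_def flat_def)
      with pos[of z] show ?thesis by simp
    qed
    show "a z * inverse (a z + b z) = 0" if "dist c z \<ge> R" for z
    proof -
      have "N z \<ge> R\<^sup>2" using that assms by (simp add: N power_mono)
      then show ?thesis by (simp add: a_def flat_def)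
    qed
  qed
qed


section \<open>Hadamard's lemma\<close>

text \<open>Differentiation under the integral sign in direction v gives an integral of the same
  shape, with K replaced by its derivative along v and the weight \<open>w t\<close> by
  \<open>w t * t\<close>. The weight is there to make the statement closed under this step.\<close>

lemma Ck_on_segment_integral:
  fixes K :: "'e::{real_inner,banach} \<Rightarrow> real"
  assumes B: "\<And>z::'e. z = (\<Sum>b\<in>B. (z \<bullet> b) *\<^sub>R b)" "finite B"
    and S: "open S" "convex S" "y \<in> S"
    and "Ck_on k S K" "continuous_on {0..1} w"
  shows "Ck_on k S (\<lambda>z. integral {0..1} (\<lambda>t. w t * K (y + t *\<^sub>R (z - y))))"
proof -
  have inS: "y + t *\<^sub>R (z - y) \<in> S" if "z \<in> S" "t \<in> {0..1}" for z t
    using convexD_alt[OF S(2,3) that(1), of t] that by (simp add: algebra_simps)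
  have segK: "continuous_on (S \<times> {0..1}) (\<lambda>x. K (y + snd x *\<^sub>R (fst x - y)))"
    if "continuous_on S K" for K :: "'e \<Rightarrow> real"
    by (rule continuous_on_compose2[OF that]) (use inS in \<open>auto intro!: continuous_intros\<close>)
  have segw: "continuous_on (S \<times> {0..1}) (\<lambda>x. w (snd x))"
    if "continuous_on {0..1} w" for w :: "real \<Rightarrow> real"
    by (rule continuous_on_compose2[OF that]) (auto intro!: continuous_intros)
  show ?thesis
    using assms(6,7)
  proof (induction k arbitrary: K w)
    case seg: 0
    have "continuous_on (S \<times> {0..1}) (\<lambda>(z, t). w t * K (y + t *\<^sub>R (z - y)))"
      using seg unfolding split_beta by (intro continuous_on_mult segK segw) auto
    then show ?case
      using integral_continuous_on_param[of S "0::real" 1] by simp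
  next
    case (Suc k)
    let ?D = "\<lambda>b z. frechet_derivative K (at z) b"
    have Dc: "continuous_on S (?D b)" for b
    proof -
      have "Ck_on k S (?D b)" using Suc.prems by simp
      then have "Ck_on 0 S (?D b)" by (induction k) (use Ck_on_lower in blast)+
      then show ?thesis by simp
    qed
    \<comment> \<open>\<open>leibniz_rule\<close> wants the derivative as a bounded linear map
      depending continuously on (z, t). Written in the basis, this continuity reduces to that of the
      scalar coefficients.\<close>
    define fx where "fx z t = (\<Sum>b\<in>B. (w t * t * ?D b (y + t *\<^sub>R (z - y))) *\<^sub>R blinfun_inner_left b)" for z t
    have fxc: "continuous_on (S \<times> {0..1}) (\<lambda>(z, t). fx z t)"
      unfolding split_beta fx_def
      by (intro continuous_intros segK segw Dc Suc.prems(2))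
    have fx_eq: "blinfun_apply (fx z t) v = w t * t * ?D v (y + t *\<^sub>R (z - y))"
      if "z \<in> S" "t \<in> {0..1}" for z t v
    proof -
      have lin: "linear (frechet_derivative K (at (y + t *\<^sub>R (z - y))))"
        using Ck_on_SucD[OF Suc.prems(1) inS[OF that]] has_derivative_linear by blast
      have "?D v (y + t *\<^sub>R (z - y)) = (\<Sum>b\<in>B. (v \<bullet> b) * ?D b (y + t *\<^sub>R (z - y)))"
        by (subst B(1)[of v]) (simp add: linear_sum[OF lin] linear_cmul[OF lin])
      then show ?thesis
        by (simp add: fx_def blinfun.sum_left blinfun.scaleR_left sum_distrib_left mult_ac inner_commute)
    qed
    have D: "((\<lambda>z. w t * K (y + t *\<^sub>R (z - y))) has_derivative blinfun_apply (fx z t)) (at z)"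
      if "z \<in> S" "t \<in> {0..1}" for z t
    proof -
      have "((\<lambda>z. y + t *\<^sub>R (z - y)) has_derivative (\<lambda>v. t *\<^sub>R v)) (at z)"
        by (auto intro!: derivative_eq_intros)
      from has_derivative_compose[OF this Ck_on_SucD[OF Suc.prems(1) inS[OF that]]]
      have "((\<lambda>z. w t * K (y + t *\<^sub>R (z - y))) has_derivative
          (\<lambda>v. w t * ?D (t *\<^sub>R v) (y + t *\<^sub>R (z - y)))) (at z)"
        by (intro has_derivative_mult_right)
      moreover have "linear (frechet_derivative K (at (y + t *\<^sub>R (z - y))))"
        using Ck_on_SucD[OF Suc.prems(1) inS[OF that]] has_derivative_linear by blast
      then have "?D (t *\<^sub>R v) (y + t *\<^sub>R (z - y)) = t * ?D v (y + t *\<^sub>R (z - y))" for v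
        by (simp add: linear_cmul)
      then have "(\<lambda>v. w t * ?D (t *\<^sub>R v) (y + t *\<^sub>R (z - y))) = blinfun_apply (fx z t)"
        by (intro ext) (simp only: fx_eq[OF that] mult.assoc)
      ultimately show ?thesis by simp
    qed
    let ?I = "\<lambda>z. integral {0..1} (\<lambda>t. w t * K (y + t *\<^sub>R (z - y)))"
    have fxz: "continuous_on {0..1} (fx z)" if "z \<in> S" for z
    proof -
      have "continuous_on {0..1::real} (Pair z)" by (intro continuous_intros)
      from continuous_on_compose2[OF fxc this] that show ?thesis by auto
    qed
    have ID: "(?I has_derivative blinfun_apply (integral {0..1} (fx z))) (at z)" if z: "z \<in> S" for z
    proof -
      have "(?I has_derivative blinfun_apply (integral (cbox 0 1) (fx z))) (at z within S)"
        unfolding cbox_interval[symmetric]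
      proof (rule leibniz_rule)
        show "(\<lambda>t. w t * K (y + t *\<^sub>R (x - y))) integrable_on cbox 0 1" if "x \<in> S" for x
        proof -
          have "continuous_on S K" using Ck_on_lower[OF Suc.prems(1)]
            by (meson Suc.prems(1) Ck_on.simps(2) differentiable_at_imp_differentiable_on differentiable_imp_continuous_on)
          then have "continuous_on {0..1} (\<lambda>t. K (y + t *\<^sub>R (x - y)))"
            by (rule continuous_on_compose2) (use inS that in \<open>auto intro!: continuous_intros\<close>)
          with Suc.prems(2) show ?thesis
            by (simp add: integrable_continuous_interval continuous_on_mult)
        qed
      qed (use D fxc z S in \<open>auto intro: has_derivative_at_withinI\<close>)
      then show ?thesis using at_within_open[OF z S(1)] by simp
    qed
    show ?case
    proof (rule Ck_on_SucI[OF S(1) ID])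
      fix v
      have "Ck_on k S (\<lambda>z. integral {0..1} (\<lambda>t. (w t * t) * ?D v (y + t *\<^sub>R (z - y))))"
        using Suc.prems by (intro Suc.IH) (auto intro!: continuous_intros)
      moreover have "integral {0..1} (\<lambda>t. (w t * t) * ?D v (y + t *\<^sub>R (z - y)))
          = blinfun_apply (integral {0..1} (fx z)) v" if "z \<in> S" for z
      proof -
        have "blinfun_apply (integral {0..1} (fx z)) v = integral {0..1} (\<lambda>t. blinfun_apply (fx z t) v)"
          by (rule blinfun_apply_integral)
            (use fxz that in \<open>auto intro!: integrable_continuous_interval\<close>)
        also have "\<dots> = integral {0..1} (\<lambda>t. (w t * t) * ?D v (y + t *\<^sub>R (z - y)))"
          by (rule integral_cong) (use fx_eq that in auto)
        finally show ?thesis by simp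
      qed
      ultimately show "Ck_on k S (\<lambda>z. blinfun_apply (integral {0..1} (fx z)) v)"
        by (rule Ck_on_cong[OF S(1), rotated])
    qed
  qed
qed

text \<open>The fundamental theorem of calculus along the segment from y to z expresses F z - F y as
  the integral of the derivative in direction z - y. Expanding z - y in B gives the
  coefficients.\<close>

lemma Hadamard:
  fixes F :: "'e::{real_inner,banach} \<Rightarrow> real"
  assumes B: "\<And>z::'e. z = (\<Sum>b\<in>B. (z \<bullet> b) *\<^sub>R b)" "finite B"
    and S: "open S" "convex S" "y \<in> S"
    and F: "smooth_on S F"
  obtains g where "\<And>b. smooth_on S (g b)" "\<And>b. g b y = frechet_derivative F (at y) b"
    "\<And>z. z \<in> S \<Longrightarrow> F z = F y + (\<Sum>b\<in>B. ((z - y) \<bullet> b) * g b z)"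
proof
  let ?D = "\<lambda>b z. frechet_derivative F (at z) b"
  \<comment> \<open>The factor 1 is the constant weight w of
    \<open>Ck_on_segment_integral\<close>.\<close>
  define g where "g b z = integral {0..1} (\<lambda>t::real. 1 * ?D b (y + t *\<^sub>R (z - y)))" for b z
  have FC: "Ck_on k S (?D b)" for k b
  proof -
    have "Ck_on (Suc k) S F" using F unfolding smooth_on_def by blast
    then show ?thesis by simp
  qed
  show "smooth_on S (g b)" for b
    using Ck_on_segment_integral[OF B S FC continuous_on_const] unfolding smooth_on_def g_def by blast
  show "g b y = ?D b y" for b by (simp add: g_def)
  fix z assume z: "z \<in> S"
  have inS: "y + t *\<^sub>R (z - y) \<in> S" if "t \<in> {0..1}" for t
    using convexD_alt[OF S(2,3) z, of t] that by (simp add: algebra_simps)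
  have F1: "Ck_on (Suc 0) S F" using F unfolding smooth_on_def by blast
  have D: "((\<lambda>t. F (y + t *\<^sub>R (z - y))) has_vector_derivative ?D (z - y) (y + t *\<^sub>R (z - y))) (at t within {0..1})"
    if "t \<in> {0..1}" for t
  proof -
    have "((\<lambda>t. y + t *\<^sub>R (z - y)) has_derivative (\<lambda>s. s *\<^sub>R (z - y))) (at t within {0..1})"
      by (auto intro!: derivative_eq_intros)
    from has_derivative_compose[OF this Ck_on_SucD[OF F1 inS[OF that]]]
    show ?thesis
      unfolding has_vector_derivative_def
      using linear_cmul[OF has_derivative_linear[OF Ck_on_SucD[OF F1 inS[OF that]]]] by simp
  qed
  have "((\<lambda>t. ?D (z - y) (y + t *\<^sub>R (z - y))) has_integral F (y + 1 *\<^sub>R (z - y)) - F (y + 0 *\<^sub>R (z - y))) {0..1}"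
    by (rule fundamental_theorem_of_calculus) (use D in auto)
  then have "F z - F y = integral {0..1} (\<lambda>t. ?D (z - y) (y + t *\<^sub>R (z - y)))"
    by (simp add: integral_unique)
  also have "\<dots> = integral {0..1} (\<lambda>t. \<Sum>b\<in>B. ((z - y) \<bullet> b) * (1 * ?D b (y + t *\<^sub>R (z - y))))"
  proof (rule integral_cong)
    fix t :: real assume "t \<in> {0..1}"
    note lin = has_derivative_linear[OF Ck_on_SucD[OF F1 inS[OF this]]]
    show "?D (z - y) (y + t *\<^sub>R (z - y)) = (\<Sum>b\<in>B. ((z - y) \<bullet> b) * (1 * ?D b (y + t *\<^sub>R (z - y))))"
      by (subst B(1)[of "z - y"]) (simp only: linear_sum[OF lin] linear_cmul[OF lin] o_def, simp)
  qed
  also have "\<dots> = (\<Sum>b\<in>B. ((z - y) \<bullet> b) * g b z)"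
  proof -
    have "(\<lambda>t. 1 * ?D b (y + t *\<^sub>R (z - y))) integrable_on {0..1}" for b
    proof -
      have "continuous_on S (?D b)" using FC[of 0 b] by simp
      then have "continuous_on {0..1} (\<lambda>t. ?D b (y + t *\<^sub>R (z - y)))"
        by (rule continuous_on_compose2) (use inS in \<open>auto intro!: continuous_intros\<close>)
      then show ?thesis by (simp add: integrable_continuous_interval)
    qed
    then show ?thesis unfolding g_def
      by (subst integral_sum) (auto intro!: B(2) integrable_on_mult_right)
  qed
  finally show "F z = F y + (\<Sum>b\<in>B. ((z - y) \<bullet> b) * g b z)" by simp
qed


section \<open>Finite-dimensional inner product spaces\<close>

text \<open>Orthogonalise the spanning set, discard 0 and normalise. The basis may be empty, which
  covers a model space of dimension 0.\<close>

lemma orthonormal_basis_exists: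
  assumes "finite (C :: 'e::real_inner set)" "span C = UNIV"
  obtains B :: "'e::real_inner set" where "finite B" "card B = dim (UNIV :: 'e::real_inner set)"
    "\<And>z. z = (\<Sum>b\<in>B. (z \<bullet> b) *\<^sub>R b)"
    "\<And>b c. b \<in> B \<Longrightarrow> c \<in> B \<Longrightarrow> b \<bullet> c = (if b = c then 1 else 0)"
proof -
  obtain D where D: "finite D" "span D = (UNIV :: 'e set)" "pairwise orthogonal D"
    using basis_orthogonal[OF assms(1)] assms(2) by auto
  define B where "B = (\<lambda>x. x /\<^sub>R norm x) ` (D - {0})"
  have fin: "finite B" using D(1) by (simp add: B_def)
  have ortho: "b \<bullet> c = (if b = c then 1 else 0)" if b: "b \<in> B" and c: "c \<in> B" for b c
  proof -
    obtain x y where xy: "x \<in> D" "x \<noteq> 0" "b = x /\<^sub>R norm x" "y \<in> D" "y \<noteq> 0" "c = y /\<^sub>R norm y"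
      using b c unfolding B_def by blast
    show ?thesis
    proof (cases "x = y")
      case True
      then show ?thesis using xy by (simp add: dot_square_norm power2_eq_square)
    next
      case False
      then have "x \<bullet> y = 0" using D(3) xy unfolding pairwise_def orthogonal_def by blast
      then have "b \<bullet> c = 0" by (simp add: xy)
      moreover have "b \<bullet> b \<noteq> 0" using xy by simp
      ultimately show ?thesis by auto
    qed
  qed
  have "D \<subseteq> span B"
  proof
    fix x assume x: "x \<in> D"
    show "x \<in> span B"
    proof (cases "x = 0")
      case False
      then have "norm x *\<^sub>R (x /\<^sub>R norm x) \<in> span B"
        using x by (intro span_scale span_base) (auto simp: B_def)
      with False show ?thesis by simp
    qed (simp add: span_zero)
  qed
  then have span: "span B = UNIV" using D(2) by (metis span_minimal subspace_span top.extremum_uniqueI)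
  have ind: "independent B"
    by (rule pairwise_orthogonal_independent) (use ortho in \<open>force simp: pairwise_def orthogonal_def\<close>)+
  show ?thesis
  proof
    show "card B = dim (UNIV :: 'e set)"
      using dim_span_eq_card_independent[OF ind] span by simp
    fix z :: 'e
    have "z \<in> range (\<lambda>u. \<Sum>b\<in>B. u b *\<^sub>R b)"
      using span span_finite[OF fin] by simp
    then obtain u where u: "z = (\<Sum>b\<in>B. u b *\<^sub>R b)" by blast
    have "z \<bullet> c = u c" if "c \<in> B" for c
    proof -
      have "z \<bullet> c = (\<Sum>b\<in>B. if b = c then u b else 0)"
        unfolding u by (simp add: inner_sum_left ortho that cong: sum.cong) (intro sum.cong; simp)
      then show ?thesis using fin that by simp
    qed
    then show "z = (\<Sum>b\<in>B. (z \<bullet> b) *\<^sub>R b)" by (subst u) (intro sum.cong; simp)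
  qed (use fin ortho in auto)
qed

text \<open>By induction, the image of a cube under a continuous map: each new basis vector
  contributes a compact interval of coefficients.\<close>

lemma compact_combinations:
  assumes "finite (B :: 'e::real_normed_vector set)"
  shows "compact {\<Sum>b\<in>B. t b *\<^sub>R b | t. \<forall>b\<in>B. \<bar>t b\<bar> \<le> r}"
  using assms
proof (induction B)
  case (insert b B)
  let ?K = "\<lambda>B. {\<Sum>b\<in>B. t b *\<^sub>R b | t. \<forall>b\<in>B. \<bar>t b\<bar> \<le> r}"
  have "?K (insert b B) = (\<lambda>(s, x). s *\<^sub>R b + x) ` ({- r..r} \<times> ?K B)" (is "_ = ?R")
  proof
    show "?K (insert b B) \<subseteq> ?R"
    proof clarsimp
      fix t assume "\<bar>t b\<bar> \<le> r" "\<forall>b\<in>B. \<bar>t b\<bar> \<le> r"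
      then show "(\<Sum>b\<in>insert b B. t b *\<^sub>R b) \<in> ?R"
        using insert.hyps
        by (intro image_eqI[of _ _ "(t b, \<Sum>b\<in>B. t b *\<^sub>R b)"]) auto
    qed
    show "?R \<subseteq> ?K (insert b B)"
    proof clarsimp
      fix s t assume st: "- r \<le> s" "s \<le> r" "\<forall>b\<in>B. \<bar>t b\<bar> \<le> r"
      have "(\<Sum>c\<in>B. (t(b := s)) c *\<^sub>R c) = (\<Sum>c\<in>B. t c *\<^sub>R c)"
        using insert.hyps by (intro sum.cong) auto
      then show "\<exists>ta. s *\<^sub>R b + (\<Sum>b\<in>B. t b *\<^sub>R b) = (\<Sum>b\<in>insert b B. ta b *\<^sub>R b) \<and>
           \<bar>ta b\<bar> \<le> r \<and> (\<forall>b\<in>B. \<bar>ta b\<bar> \<le> r)"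
        using st insert.hyps by (intro exI[of _ "t(b := s)"]) (auto simp: sum.insert)
    qed
  qed
  moreover have "compact ?R"
    using insert.IH
    by (intro compact_continuous_image compact_Times compact_Icc)
      (auto simp: split_beta intro!: continuous_intros)
  ultimately show ?case by simp
qed simp

text \<open>By Cauchy-Schwarz the coefficients of a vector of the ball around 0 are bounded by r, so
  this ball is a closed subset of a compact set of combinations; translation does the rest.\<close>

lemma compact_cball_finite_basis:
  fixes B :: "'e::real_inner set"
  assumes "finite B" and z: "\<And>z. z = (\<Sum>b\<in>B. (z \<bullet> b) *\<^sub>R b)"
    and unit: "\<And>b. b \<in> B \<Longrightarrow> norm b = 1"
  shows "compact (cball (c :: 'e) r)"
proof -
  let ?K = "{\<Sum>b\<in>B. t b *\<^sub>R b | t. \<forall>b\<in>B. \<bar>t b\<bar> \<le> r}"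
  have "cball 0 r \<subseteq> ?K"
  proof
    fix x :: 'e assume "x \<in> cball 0 r"
    then have "\<bar>x \<bullet> b\<bar> \<le> r" if "b \<in> B" for b
      using Cauchy_Schwarz_ineq2[of x b] unit[OF that] by simp
    then show "x \<in> ?K" using z[of x] by blast
  qed
  then have "compact (?K \<inter> cball 0 r)" "?K \<inter> cball 0 r = cball 0 r"
    using compact_combinations[OF assms(1), of r] by (auto intro: compact_Int_closed)
  then have "compact ((+) c ` cball 0 r)"
    by (metis compact_translation)
  then show ?thesis by simp
qed


section \<open>Smooth functions and tangent vectors\<close>

locale smooth_mfd =
  fixes A :: "('a::{t2_space,second_countable_topology}, 'e::{real_inner,banach}) atlas"
  assumes mfd: "smooth_manifold A"
begin

abbreviation "C \<equiv> smooth_fun A"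
abbreviation "T \<equiv> tangent_space A"
abbreviation "VF \<equiv> vector_fields A"

lemma chart:
  assumes "(U, \<phi>) \<in> A"
  shows "open U \<and> open (\<phi> ` U) \<and> homeomorphism U (\<phi> ` U) \<phi> (inv_into U \<phi>)"
proof -
  have "\<forall>(U, \<phi>)\<in>A. open U \<and> open (\<phi> ` U) \<and> homeomorphism U (\<phi> ` U) \<phi> (inv_into U \<phi>)"
    using mfd unfolding smooth_manifold_def by (elim conjE)
  from bspec[OF this assms] show ?thesis by simp
qed

lemmas chart_open = chart[THEN conjunct1] chart[THEN conjunct2, THEN conjunct1]
  and chart_homeo = chart[THEN conjunct2, THEN conjunct2]

lemma chart_inv: "(U, \<phi>) \<in> A \<Longrightarrow> q \<in> U \<Longrightarrow> inv_into U \<phi> (\<phi> q) = q"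
  by (rule homeomorphism_apply1[OF chart_homeo])

lemma chart_cover: "\<exists>U \<phi>. (U, \<phi>) \<in> A \<and> p \<in> U"
proof -
  have "p \<in> (\<Union>(U, \<phi>)\<in>A. U)" using mfd unfolding smooth_manifold_def by simp
  then show ?thesis by auto
qed

lemma transition:
  assumes "(U, \<phi>) \<in> A" "(V, \<psi>) \<in> A"
  shows "smooth_on (\<phi> ` (U \<inter> V)) (\<psi> \<circ> inv_into U \<phi>)"
proof -
  have "\<forall>(U, \<phi>)\<in>A. \<forall>(V, \<psi>)\<in>A. smooth_on (\<phi> ` (U \<inter> V)) (\<psi> \<circ> inv_into U \<phi>)"
    using mfd unfolding smooth_manifold_def by (elim conjE)
  from bspec[OF this assms(1)] assms(2) show ?thesis by auto
qed

lemma smooth_fun_iff: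
  "f \<in> C \<longleftrightarrow> (\<forall>(U, \<phi>)\<in>A. \<forall>k. Ck_on k (\<phi> ` U) (\<lambda>y. f (inv_into U \<phi> y)))"
  by (simp add: smooth_fun_def smooth_on_def o_def)

lemma smooth_funD: "f \<in> C \<Longrightarrow> (U, \<phi>) \<in> A \<Longrightarrow> Ck_on k (\<phi> ` U) (\<lambda>y. f (inv_into U \<phi> y))"
  unfolding smooth_fun_iff by (drule (1) bspec) simp

lemma smooth_funI:
  "(\<And>U \<phi> k. (U, \<phi>) \<in> A \<Longrightarrow> Ck_on k (\<phi> ` U) (\<lambda>y. f (inv_into U \<phi> y))) \<Longrightarrow> f \<in> C"
  unfolding smooth_fun_iff by (intro ballI) (simp add: split_beta)

lemma smooth_fun_const: "(\<lambda>x. c) \<in> C"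
  by (rule smooth_funI) (rule Ck_on_const)

lemma smooth_fun_add: "f \<in> C \<Longrightarrow> g \<in> C \<Longrightarrow> (\<lambda>x. f x + g x) \<in> C"
  by (rule smooth_funI) (rule Ck_on_add[OF chart_open(2) smooth_funD smooth_funD]; assumption)

lemma smooth_fun_mult: "f \<in> C \<Longrightarrow> g \<in> C \<Longrightarrow> (\<lambda>x. f x * g x) \<in> C"
  by (rule smooth_funI) (rule Ck_on_mult[OF chart_open(2) smooth_funD smooth_funD]; assumption)

lemma smooth_fun_cmult: "f \<in> C \<Longrightarrow> (\<lambda>x. c * f x) \<in> C"
  using smooth_fun_mult[OF smooth_fun_const] .

lemma smooth_fun_uminus: "f \<in> C \<Longrightarrow> (\<lambda>x. - f x) \<in> C"
  using smooth_fun_cmult[of f "- 1"] by simp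

lemma smooth_fun_diff: "f \<in> C \<Longrightarrow> g \<in> C \<Longrightarrow> (\<lambda>x. f x - g x) \<in> C"
  using smooth_fun_add[OF _ smooth_fun_uminus, of f g] by simp

lemma smooth_fun_sum: "(\<And>i. i \<in> I \<Longrightarrow> f i \<in> C) \<Longrightarrow> (\<lambda>x. \<Sum>i\<in>I. f i x) \<in> C"
  by (induction I rule: infinite_finite_induct) (auto intro: smooth_fun_const smooth_fun_add)

lemmas smooth_fun_intros = smooth_fun_const smooth_fun_add smooth_fun_mult smooth_fun_uminus
  smooth_fun_diff smooth_fun_sum

lemma model_basis:
  obtains B :: "'e set" where "finite B" "card B = dim (UNIV :: 'e set)"
    "\<And>z. z = (\<Sum>b\<in>B. (z \<bullet> b) *\<^sub>R b)"
    "\<And>b c. b \<in> B \<Longrightarrow> c \<in> B \<Longrightarrow> b \<bullet> c = (if b = c then 1 else 0)"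
proof -
  have "\<exists>B :: 'e set. finite B \<and> span B = UNIV"
    using mfd unfolding smooth_manifold_def by (rule conjunct1)
  then obtain B :: "'e set" where B: "finite B" "span B = UNIV" by blast
  show ?thesis by (rule orthonormal_basis_exists[OF B]) (rule that)
qed

text \<open>The preimage L of K is compact, hence closed in the Hausdorff space. The image of any
  other chart domain V is therefore covered by two open sets: that of V \<inter> U, where the
  transition map applies, and that of V - L, where the function is 0.\<close>

lemma smooth_fun_extend:
  assumes U: "(U, \<phi>) \<in> A" and W: "open W" "W \<subseteq> \<phi> ` U" and K: "compact K" "K \<subseteq> W"
    and G: "\<And>k. Ck_on k W G" and G0: "\<And>y. y \<in> \<phi> ` U \<Longrightarrow> y \<notin> K \<Longrightarrow> G y = 0"
  shows "(\<lambda>q. if q \<in> U then G (\<phi> q) else 0) \<in> C"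
proof -
  obtain B :: "'e set" where "finite B" "card B = dim (UNIV :: 'e set)"
    and B: "\<And>z. z = (\<Sum>b\<in>B. (z \<bullet> b) *\<^sub>R b)"
    and "\<And>b c. b \<in> B \<Longrightarrow> c \<in> B \<Longrightarrow> b \<bullet> c = (if b = c then 1 else 0)"
    by (rule model_basis) (rule that)
  \<comment> \<open>G is smooth on W by assumption and zero on the complement of K, and these two
    open sets cover the chart image.\<close>
  have GU: "Ck_on k (\<phi> ` U) G" for k
  proof -
    have o: "open (\<phi> ` U - K)" using chart_open(2)[OF U] compact_imp_closed[OF K(1)] by (rule open_Diff)
    have "Ck_on k (\<phi> ` U - K) G"
      by (rule Ck_on_cong[OF o _ Ck_on_const[of _ _ 0]]) (simp add: G0)
    then have "Ck_on k (W \<union> (\<phi> ` U - K)) G" by (rule Ck_on_Un[OF W(1) o G])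
    moreover have "W \<union> (\<phi> ` U - K) = \<phi> ` U" using W(2) K(2) by blast
    ultimately show ?thesis by simp
  qed
  define L where "L = inv_into U \<phi> ` K"
  have "continuous_on K (inv_into U \<phi>)"
    by (rule continuous_on_subset[OF homeomorphism_cont2[OF chart_homeo[OF U]]]) (use W(2) K(2) in auto)
  then have "closed L" using K(1) unfolding L_def by (intro compact_imp_closed compact_continuous_image)
  have LU: "L \<subseteq> U" using K(2) W(2) unfolding L_def by (auto intro!: inv_into_into)
  have L: "\<phi> q \<notin> K" if "q \<in> U" "q \<notin> L" for q
  proof
    assume "\<phi> q \<in> K"
    then have "inv_into U \<phi> (\<phi> q) \<in> L" unfolding L_def by (rule imageI)
    then show False using that chart_inv[OF U] by simp
  qed
  let ?F = "\<lambda>q. if q \<in> U then G (\<phi> q) else 0"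
  have "Ck_on k (\<psi> ` V) (?F \<circ> inv_into V \<psi>)" if V: "(V, \<psi>) \<in> A" for V \<psi> k
  proof -
    have im: "open (\<psi> ` O')" if "O' \<subseteq> V" "open O'" for O'
    proof -
      have "openin (top_of_set (\<psi> ` V)) (\<psi> ` O')"
        using that by (intro homeomorphism_imp_open_map[OF chart_homeo[OF V]]) (auto intro: open_subset)
      then show ?thesis using openin_open_eq[OF chart_open(2)[OF V]] by simp
    qed
    note inv = chart_inv[OF V]
    have o1: "open (\<psi> ` (V \<inter> U))" using chart_open(1)[OF U] chart_open(1)[OF V] by (intro im) auto
    have o2: "open (\<psi> ` (V - L))" using chart_open(1)[OF V] \<open>closed L\<close> by (intro im) auto
    have "Ck_on k (\<psi> ` (V \<inter> U)) (\<lambda>y. G ((\<phi> \<circ> inv_into V \<psi>) y))"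
      using transition[OF V U] inv
      by (intro Ck_on_compose[OF B o1 chart_open(2)[OF U] _ _ GU]) (auto simp: smooth_on_def o_def)
    then have 1: "Ck_on k (\<psi> ` (V \<inter> U)) (?F \<circ> inv_into V \<psi>)"
      by (rule Ck_on_cong[OF o1, rotated]) (auto simp: inv)
    have 2: "Ck_on k (\<psi> ` (V - L)) (?F \<circ> inv_into V \<psi>)"
      by (rule Ck_on_cong[OF o2 _ Ck_on_const[of _ _ 0]]) (auto simp: inv G0 L)
    have "\<psi> ` (V \<inter> U) \<union> \<psi> ` (V - L) = \<psi> ` V" using LU by blast
    with Ck_on_Un[OF o1 o2 1 2] show ?thesis by simp
  qed
  then show ?thesis by (intro smooth_funI) (simp add: o_def)
qed

lemma tangent_space_iff:
  "v \<in> T q \<longleftrightarrow> (\<forall>f\<in>C. \<forall>g\<in>C. (\<forall>a b. v (\<lambda>x. a * f x + b * g x) = a * v f + b * v g) \<and>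
     v (\<lambda>x. f x * g x) = f q * v g + v f * g q) \<and> (\<forall>f. f \<notin> C \<longrightarrow> v f = 0)"
  unfolding tangent_space_def mem_Collect_eq ..

lemma tv_lin: "v \<in> T q \<Longrightarrow> f \<in> C \<Longrightarrow> g \<in> C \<Longrightarrow> v (\<lambda>x. a * f x + b * g x) = a * v f + b * v g"
  unfolding tangent_space_iff by (elim conjE) (drule (1) bspec, drule (1) bspec, elim conjE allE)

lemma tv_mult: "v \<in> T q \<Longrightarrow> f \<in> C \<Longrightarrow> g \<in> C \<Longrightarrow> v (\<lambda>x. f x * g x) = f q * v g + v f * g q"
  unfolding tangent_space_iff by (elim conjE) (drule (1) bspec, drule (1) bspec, elim conjE)

lemma tv_outside: "v \<in> T q \<Longrightarrow> f \<notin> C \<Longrightarrow> v f = 0"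
  unfolding tangent_space_iff by (elim conjE allE impE)

lemma tv_add: "v \<in> T q \<Longrightarrow> f \<in> C \<Longrightarrow> g \<in> C \<Longrightarrow> v (\<lambda>x. f x + g x) = v f + v g"
  using tv_lin[of v q f g 1 1] by simp

lemma tv_diff: "v \<in> T q \<Longrightarrow> f \<in> C \<Longrightarrow> g \<in> C \<Longrightarrow> v (\<lambda>x. f x - g x) = v f - v g"
  using tv_lin[of v q f g 1 "- 1"] by simp

lemma tv_const: "v \<in> T q \<Longrightarrow> v (\<lambda>x. c) = 0"
  using tv_mult[of v q "\<lambda>x. 1" "\<lambda>x. 1"] tv_lin[of v q "\<lambda>x. 1" "\<lambda>x. 1" c 0]
  by (simp add: smooth_fun_const)

lemma tv_cmult: "v \<in> T q \<Longrightarrow> f \<in> C \<Longrightarrow> v (\<lambda>x. c * f x) = c * v f"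
  using tv_lin[of v q f f c 0] by simp

lemma tv_uminus: "v \<in> T q \<Longrightarrow> f \<in> C \<Longrightarrow> v (\<lambda>x. - f x) = - v f"
  using tv_cmult[of v q f "- 1"] by simp

lemma tv_sum:
  "v \<in> T q \<Longrightarrow> (\<And>i. i \<in> I \<Longrightarrow> f i \<in> C) \<Longrightarrow> v (\<lambda>x. \<Sum>i\<in>I. f i x) = (\<Sum>i\<in>I. v (f i))"
  by (induction I rule: infinite_finite_induct)
    (auto simp: tv_const tv_add[OF _ _ smooth_fun_sum])

lemma tvI:
  assumes "\<And>f g a b. f \<in> C \<Longrightarrow> g \<in> C \<Longrightarrow> v (\<lambda>x. a * f x + b * g x) = a * v f + b * v g"
    and "\<And>f g. f \<in> C \<Longrightarrow> g \<in> C \<Longrightarrow> v (\<lambda>x. f x * g x) = f q * v g + v f * g q"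
    and "\<And>f. f \<notin> C \<Longrightarrow> v f = 0"
  shows "v \<in> T q"
  unfolding tangent_space_iff by (intro conjI ballI allI impI assms)

lemma tv_combination:
  assumes "u \<in> T q" "v \<in> T q"
  shows "(\<lambda>f. a * u f + b * v f) \<in> T q"
proof (rule tvI)
  show "a * u (\<lambda>x. c * f x + d * g x) + b * v (\<lambda>x. c * f x + d * g x)
      = c * (a * u f + b * v f) + d * (a * u g + b * v g)" if "f \<in> C" "g \<in> C" for f g c d
    using tv_lin[OF assms(1) that] tv_lin[OF assms(2) that] by (simp add: algebra_simps)
  show "a * u (\<lambda>x. f x * g x) + b * v (\<lambda>x. f x * g x)
      = f q * (a * u g + b * v g) + (a * u f + b * v f) * g q" if "f \<in> C" "g \<in> C" for f g
    using tv_mult[OF assms(1) that] tv_mult[OF assms(2) that] by (simp add: algebra_simps)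
  show "a * u f + b * v f = 0" if "f \<notin> C" for f
    using tv_outside[OF assms(1) that] tv_outside[OF assms(2) that] by simp
qed

lemma tv_zero: "(\<lambda>f. 0) \<in> T q"
  by (simp add: tangent_space_def)


section \<open>Local frames\<close>

text \<open>The vector fields \<^term>\<open>E b\<close> form a frame near \<^term>\<open>p\<close> with coframe \<^term>\<open>x b\<close>; the cutoff
  \<^term>\<open>\<eta>\<close> makes the expansion in the frame hold on the whole manifold.\<close>

definition frame_at :: "'a \<Rightarrow> 'e set \<Rightarrow> ('a \<Rightarrow> real) \<Rightarrow> ('e \<Rightarrow> 'a \<Rightarrow> real) \<Rightarrow> ('e \<Rightarrow> 'a \<Rightarrow> 'a tvec) \<Rightarrow> bool"
  where "frame_at p B \<eta> x E \<longleftrightarrow> finite B \<and> card B = dim (UNIV :: 'e set) \<and>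
    \<eta> \<in> C \<and> (\<forall>b. x b \<in> C) \<and> (\<forall>b. E b \<in> VF) \<and> \<eta> p = 1 \<and>
    (\<forall>q v f. v \<in> T q \<longrightarrow> f \<in> C \<longrightarrow> \<eta> q * v f = (\<Sum>b\<in>B. v (x b) * E b q f)) \<and>
    (\<forall>b\<in>B. \<forall>c\<in>B. E b p (x c) = (if b = c then 1 else 0))"

text \<open>Take the coordinate fields times a bump function h1, and the coordinates times a wider
  one h2 that equals 1 wherever h1 is nonzero. Applying a derivation v to Hadamard's expansion of f
  around q determines v f from the values v (x b).\<close>

lemma frame_exists: "\<exists>B \<eta> x E. frame_at p B \<eta> x E"
proof -
  obtain B :: "'e set" where fin: "finite B" and card: "card B = dim (UNIV :: 'e set)"
    and B: "\<And>z. z = (\<Sum>b\<in>B. (z \<bullet> b) *\<^sub>R b)"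
    and ortho: "\<And>b c. b \<in> B \<Longrightarrow> c \<in> B \<Longrightarrow> b \<bullet> c = (if b = c then 1 else 0)"
    by (rule model_basis) (rule that)
  obtain U \<phi> where U: "(U, \<phi>) \<in> A" and p: "p \<in> U" using chart_cover by blast
  note oU = chart_open(2)[OF U]
  note inv = chart_inv[OF U]
  have inv': "inv_into U \<phi> y \<in> U" "\<phi> (inv_into U \<phi> y) = y" if "y \<in> \<phi> ` U" for y
    using that by (auto simp: inv_into_into f_inv_into_f)
  obtain R where R: "R > 0" "cball (\<phi> p) R \<subseteq> \<phi> ` U"
    using oU p unfolding open_contains_cball by blast
  \<comment> \<open>The four nested radii are: r, up to which h1 is 1; 2r, where h1 has died out and
    up to which h2 is 1; 3r, where h2 has died out, the radius of the compact K; and 4r, the radius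
    of the convex S on which Hadamard's lemma is used.\<close>
  define r where "r = R / 4"
  have r: "r > 0" using R by (simp add: r_def)
  define S where "S = ball (\<phi> p) (4 * r)"
  define K where "K = cball (\<phi> p) (3 * r)"
  have S: "open S" "convex S" "S \<subseteq> \<phi> ` U" and K: "compact K" "K \<subseteq> S"
  proof -
    have "norm b = 1" if "b \<in> B" for b using ortho[OF that that] by (simp add: norm_eq_sqrt_inner)
    then show "compact K" unfolding K_def using compact_cball_finite_basis[OF fin B] by blast
    show "K \<subseteq> S" "S \<subseteq> \<phi> ` U" using r R(2) by (auto simp: K_def S_def r_def)
  qed (auto simp: S_def)
  obtain h1 :: "'e \<Rightarrow> real" where h1: "\<And>k. Ck_on k UNIV h1"
      "\<And>z. dist (\<phi> p) z \<le> r \<Longrightarrow> h1 z = 1" "\<And>z. dist (\<phi> p) z \<ge> 2 * r \<Longrightarrow> h1 z = 0"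
    by (rule bump_exists[of r "2 * r" "\<phi> p"]) (use r that in auto)
  obtain h2 :: "'e \<Rightarrow> real" where h2: "\<And>k. Ck_on k UNIV h2"
      "\<And>z. dist (\<phi> p) z \<le> 2 * r \<Longrightarrow> h2 z = 1" "\<And>z. dist (\<phi> p) z \<ge> 3 * r \<Longrightarrow> h2 z = 0"
    by (rule bump_exists[of "2 * r" "3 * r" "\<phi> p"]) (use r that in auto)
  have h1K: "h1 y = 0" and h2K: "h2 y = 0" if "y \<notin> K" for y
    using that h1(3) h2(3) r by (auto simp: K_def)
  define ext where "ext G = (\<lambda>q. if q \<in> U then G (\<phi> q) else 0)" for G :: "'e \<Rightarrow> real"
  have ext1: "ext (\<lambda>y. h1 y * G y) \<in> C" if "\<And>k. Ck_on k S G" for G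
    unfolding ext_def using that S h1K K
    by (intro smooth_fun_extend[OF U S(1,3) K]) (auto intro!: Ck_on_mult intro: Ck_on_subset[OF h1(1)])
  have ext2: "ext (\<lambda>y. h2 y * G y) \<in> C" if "\<And>k. Ck_on k S G" for G
    unfolding ext_def using that S h2K K
    by (intro smooth_fun_extend[OF U S(1,3) K]) (auto intro!: Ck_on_mult intro: Ck_on_subset[OF h2(1)])
  let ?loc = "\<lambda>f. f \<circ> inv_into U \<phi>"
  let ?D = "\<lambda>f b y. frechet_derivative (?loc f) (at y) b"
  define \<eta> where "\<eta> = ext h1"
  define \<kappa> where "\<kappa> = ext h2"
  define x where "x b = ext (\<lambda>y. h2 y * (y \<bullet> b))" for b
  define E where "E b q f = (if q \<in> U \<and> f \<in> C then h1 (\<phi> q) * ?D f b (\<phi> q) else 0)" for b q f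
  have \<eta>: "\<eta> \<in> C" and \<kappa>: "\<kappa> \<in> C"
    using ext1[of "\<lambda>y. 1"] ext2[of "\<lambda>y. 1"] by (auto simp: \<eta>_def \<kappa>_def Ck_on_const)
  have x: "x b \<in> C" for b
    unfolding x_def by (intro ext2 Ck_on_linear S(1) bounded_linear_inner_left)
  have locC: "Ck_on k (\<phi> ` U) (?loc f)" if "f \<in> C" for f k
    using smooth_funD[OF that U] by (simp add: o_def)
  have locD: "(?loc f has_derivative frechet_derivative (?loc f) (at (\<phi> q))) (at (\<phi> q))"
    if "f \<in> C" "q \<in> U" for f q
    using Ck_on_SucD[OF locC[OF that(1), of "Suc 0"]] that(2) by blast
  have E: "E b \<in> VF" for b
  proof -
    have "E b q \<in> T q" for q
    proof (cases "q \<in> U")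
      case True
      have lin: "?D (\<lambda>x. a * f x + c * g x) b (\<phi> q) = a * ?D f b (\<phi> q) + c * ?D g b (\<phi> q)"
        if fg: "f \<in> C" "g \<in> C" for f g a c
      proof -
        have "((\<lambda>y. a * ?loc f y + c * ?loc g y) has_derivative
          (\<lambda>v. a * ?D f v (\<phi> q) + c * ?D g v (\<phi> q))) (at (\<phi> q))"
          by (intro derivative_intros locD fg True)
        from has_derivative_imp_frechet[OF this] show ?thesis by (simp add: o_def)
      qed
      have mult: "?D (\<lambda>x. f x * g x) b (\<phi> q) = f q * ?D g b (\<phi> q) + ?D f b (\<phi> q) * g q"
        if fg: "f \<in> C" "g \<in> C" for f g
      proof -
        have "((\<lambda>y. ?loc f y * ?loc g y) has_derivative
          (\<lambda>v. ?loc f (\<phi> q) * ?D g v (\<phi> q) + ?D f v (\<phi> q) * ?loc g (\<phi> q))) (at (\<phi> q))"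
          by (intro has_derivative_mult locD fg True)
        from has_derivative_imp_frechet[OF this] show ?thesis by (simp add: o_def inv True)
      qed
      show ?thesis
        using True by (intro tvI) (simp_all add: E_def lin mult smooth_fun_intros algebra_simps)
    qed (simp add: E_def[abs_def] tv_zero)
    moreover have "(\<lambda>q. E b q f) \<in> C" if f: "f \<in> C" for f
    proof -
      have "Ck_on k S (?D f b)" for k
        using locC[OF f, of "Suc k"] Ck_on_subset[OF _ S(3)] by auto
      then have "ext (\<lambda>y. h1 y * ?D f b y) \<in> C" by (rule ext1)
      moreover have "ext (\<lambda>y. h1 y * ?D f b y) = (\<lambda>q. E b q f)"
        using f by (auto simp: ext_def E_def)
      ultimately show ?thesis by simp
    qed
    ultimately show ?thesis by (simp add: vector_fields_def)
  qed
  have frame: "\<eta> q * v f = (\<Sum>b\<in>B. v (x b) * E b q f)" if v: "v \<in> T q" and f: "f \<in> C" for q v f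
  proof (cases "q \<in> U \<and> h1 (\<phi> q) \<noteq> 0")
    case False
    then have "E b q f = 0" for b by (auto simp: E_def)
    with False show ?thesis by (auto simp: \<eta>_def ext_def)
  next
    case True
    then have q: "q \<in> U" "dist (\<phi> p) (\<phi> q) < 2 * r" using h1(3) by force+
    define y where "y = \<phi> q"
    have y: "y \<in> S" "y \<in> K" using q r by (auto simp: S_def K_def y_def)
    have "smooth_on S (?loc f)" using locC[OF f] Ck_on_subset[OF _ S(3)] by (auto simp: smooth_on_def)
    then obtain g where g: "\<And>b. smooth_on S (g b)" "\<And>b. g b y = ?D f b y"
      "\<And>z. z \<in> S \<Longrightarrow> ?loc f z = ?loc f y + (\<Sum>b\<in>B. ((z - y) \<bullet> b) * g b z)"
      by (rule Hadamard[OF B fin S(1,2) y(1)]) (rule that)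
    define G where "G b = ext (\<lambda>z. h2 z * g b z)" for b
    have G: "G b \<in> C" for b
      unfolding G_def by (intro ext2) (use g(1) in \<open>auto simp: smooth_on_def\<close>)
    have \<kappa>q: "\<kappa> q = 1" using q h2(2) by (simp add: \<kappa>_def ext_def)
    have "v (\<lambda>q. \<eta> q * \<kappa> q) = v \<eta>"
    proof -
      have "(\<lambda>q. \<eta> q * \<kappa> q) = \<eta>"
      proof
        show "\<eta> q * \<kappa> q = \<eta> q" for q
          using h1(3) h2(2) by (cases "dist (\<phi> p) (\<phi> q) < 2 * r") (auto simp: \<eta>_def \<kappa>_def ext_def)
      qed
      then show ?thesis by simp
    qed
    \<comment> \<open>The product rule gives v \<eta> = \<eta> q * v \<kappa> + v \<eta>, and \<eta>
      q is nonzero.\<close>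
    then have v\<kappa>: "v \<kappa> = 0"
      using tv_mult[OF v \<eta> \<kappa>] \<kappa>q True by (simp add: \<eta>_def ext_def)
    \<comment> \<open>Hadamard's lemma, multiplied by $\kappa^2$ to become an identity of global smooth functions\<close>
    have eq: "\<kappa> z * (\<kappa> z * (f z - f q)) = (\<Sum>b\<in>B. (x b z - (y \<bullet> b) * \<kappa> z) * G b z)" for z
    proof (cases "z \<in> U \<and> \<phi> z \<in> S")
      case True
      have "f z - f q = (\<Sum>b\<in>B. ((\<phi> z - y) \<bullet> b) * g b (\<phi> z))"
        using g(3)[of "\<phi> z"] True q by (simp add: inv y_def)
      then show ?thesis
        using True by (simp add: \<kappa>_def x_def G_def ext_def sum_distrib_left inner_diff_left algebra_simps)
    next
      case False
      then have "\<kappa> z = 0" "G b z = 0" for b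
        using h2K K(2) by (auto simp: \<kappa>_def G_def ext_def)
      then show ?thesis by simp
    qed
    \<comment> \<open>As f - f q vanishes at q and \<kappa> q = 1, the product rule leaves only v
      f.\<close>
    have "v (\<lambda>z. \<kappa> z * (\<kappa> z * (f z - f q))) = v f"
      using f \<kappa> by (simp add: tv_mult[OF v] smooth_fun_intros \<kappa>q tv_diff[OF v] tv_const[OF v])
    also have "v (\<lambda>z. \<kappa> z * (\<kappa> z * (f z - f q))) = (\<Sum>b\<in>B. v (\<lambda>z. (x b z - (y \<bullet> b) * \<kappa> z) * G b z))"
      unfolding eq using v x G \<kappa> by (intro tv_sum smooth_fun_intros) auto
    \<comment> \<open>The first factor vanishes at q and v \<kappa> = 0, so what remains is v (x b)
      times G b q, the partial derivative of f. Of the two factors \<kappa>, one went into x b and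
      the other into G b.\<close>
    also have "\<dots> = (\<Sum>b\<in>B. v (x b) * ?D f b y)"
    proof (rule sum.cong)
      fix b
      have "x b q = (y \<bullet> b)" "G b q = ?D f b y"
        using q h2(2) g(2) by (simp_all add: x_def G_def ext_def y_def)
      then show "v (\<lambda>z. (x b z - (y \<bullet> b) * \<kappa> z) * G b z) = v (x b) * ?D f b y"
        using x[of b] G[of b] \<kappa>
        by (simp add: tv_mult[OF v] smooth_fun_diff smooth_fun_cmult \<kappa>q tv_diff[OF v] tv_cmult[OF v] v\<kappa>)
    qed simp
    finally have "v f = (\<Sum>b\<in>B. v (x b) * ?D f b y)" by simp
    then show ?thesis
      using q f by (simp add: \<eta>_def ext_def E_def y_def sum_distrib_left mult_ac)
  qed
  have delta: "E b p (x c) = (if b = c then 1 else 0)" if "b \<in> B" "c \<in> B" for b c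
  proof -
    \<comment> \<open>Near p the cutoff h2 is 1, so x c is there the plain coordinate, with this
      derivative.\<close>
    have "((\<lambda>y. y \<bullet> c) has_derivative (\<lambda>v. v \<bullet> c)) (at (\<phi> p))"
      by (auto intro!: derivative_eq_intros)
    then have "(?loc (x c) has_derivative (\<lambda>v. v \<bullet> c)) (at (\<phi> p))"
    proof (rule has_derivative_transform_within_open)
      show "open (ball (\<phi> p) r)" "\<phi> p \<in> ball (\<phi> p) r" using r by auto
      fix y assume y: "y \<in> ball (\<phi> p) r"
      then have "y \<in> \<phi> ` U" using R(2) r by (auto simp: r_def subset_iff)
      with y show "y \<bullet> c = ?loc (x c) y" using h2(2) r by (simp add: x_def ext_def inv')
    qed
    from has_derivative_imp_frechet[OF this] show ?thesis
      using p x h1(2)[of "\<phi> p"] r ortho[OF that] by (simp add: E_def)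
  qed
  have "\<eta> p = 1" using p h1(2)[of "\<phi> p"] r by (simp add: \<eta>_def ext_def)
  then have "frame_at p B \<eta> x E"
    unfolding frame_at_def by (intro conjI allI ballI impI fin card \<eta> x E frame delta)
  then show ?thesis by blast
qed

abbreviation "Tc \<equiv> cotangent_space A"
abbreviation "Om \<equiv> one_forms A"
abbreviation "d \<equiv> differential A"

section \<open>Vector fields and 1-forms\<close>

lemma vf_T: "X \<in> VF \<Longrightarrow> X p \<in> T p"
  and vf_fun: "X \<in> VF \<Longrightarrow> f \<in> C \<Longrightarrow> (\<lambda>p. X p f) \<in> C"
  by (simp_all add: vector_fields_def)

lemma vf_combination:
  assumes "X \<in> VF" "Y \<in> VF" "u \<in> C" "w \<in> C"
  shows "(\<lambda>p f. u p * X p f + w p * Y p f) \<in> VF"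
  using assms unfolding vector_fields_def by (auto intro!: tv_combination smooth_fun_intros)

lemma vf_scale: "X \<in> VF \<Longrightarrow> u \<in> C \<Longrightarrow> (\<lambda>p f. u p * X p f) \<in> VF"
  using vf_combination[of X X u "\<lambda>_. 0"] by (simp add: smooth_fun_const)

lemma vf_sum:
  assumes "\<And>i. i \<in> I \<Longrightarrow> X i \<in> VF"
  shows "(\<lambda>p f. \<Sum>i\<in>I. c i * X i p f) \<in> VF"
  using assms
proof (induction I rule: infinite_finite_induct)
  case (insert i I)
  then show ?case
    using vf_combination[of "X i" "\<lambda>p f. \<Sum>i\<in>I. c i * X i p f" "\<lambda>_. c i" "\<lambda>_. 1"]
    by (simp add: smooth_fun_const)
qed (auto simp: vector_fields_def tv_zero smooth_fun_const)

lemma vf_lie_bracket: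
  assumes "X \<in> VF" "Y \<in> VF"
  shows "lie_bracket X Y \<in> VF"
proof -
  note x = vf_T[OF assms(1)] and y = vf_T[OF assms(2)]
  note xf = vf_fun[OF assms(1)] and yf = vf_fun[OF assms(2)]
  have "lie_bracket X Y p \<in> T p" for p
  proof (rule tvI)
    show "lie_bracket X Y p (\<lambda>x. a * f x + b * g x) = a * lie_bracket X Y p f + b * lie_bracket X Y p g"
      if fg: "f \<in> C" "g \<in> C" for f g a b
      by (simp add: lie_bracket_def tv_lin[OF x] tv_lin[OF y] fg xf yf algebra_simps)
    show "lie_bracket X Y p (\<lambda>x. f x * g x) = f p * lie_bracket X Y p g + lie_bracket X Y p f * g p"
      if fg: "f \<in> C" "g \<in> C" for f g
      by (simp add: lie_bracket_def tv_mult[OF x] tv_mult[OF y] tv_add[OF x] tv_add[OF y]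
          smooth_fun_mult fg xf yf algebra_simps)
    show "lie_bracket X Y p f = 0" if "f \<notin> C" for f
      using that by (simp add: lie_bracket_def tv_outside[OF x] tv_outside[OF y] tv_const[OF x] tv_const[OF y])
  qed
  then show ?thesis
    using assms by (auto simp: vector_fields_def lie_bracket_def intro!: smooth_fun_diff)
qed

lemma lie_bracket_scale_right:
  assumes "X \<in> VF" "Y \<in> VF" "h \<in> C"
  shows "lie_bracket X (\<lambda>p f. h p * Y p f) = (\<lambda>p f. X p h * Y p f + h p * lie_bracket X Y p f)"
proof (intro ext)
  fix p f
  show "lie_bracket X (\<lambda>p f. h p * Y p f) p f = X p h * Y p f + h p * lie_bracket X Y p f"
  proof (cases "f \<in> C")
    case True
    then show ?thesis
      using assms by (simp add: lie_bracket_def tv_mult[OF vf_T[OF assms(1)]] vf_fun algebra_simps)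
  next
    case False
    then show ?thesis
      using assms by (simp add: lie_bracket_def tv_outside[OF vf_T] tv_const[OF vf_T])
  qed
qed

lemma lie_bracket_scale_left:
  assumes "X \<in> VF" "Y \<in> VF" "h \<in> C"
  shows "lie_bracket (\<lambda>p f. h p * X p f) Y = (\<lambda>p f. h p * lie_bracket X Y p f + (- Y p h) * X p f)"
proof (intro ext)
  fix p f
  show "lie_bracket (\<lambda>p f. h p * X p f) Y p f = h p * lie_bracket X Y p f + (- Y p h) * X p f"
  proof (cases "f \<in> C")
    case True
    then show ?thesis
      using assms by (simp add: lie_bracket_def tv_mult[OF vf_T[OF assms(2)]] vf_fun algebra_simps)
  next
    case False
    then show ?thesis
      using assms by (simp add: lie_bracket_def tv_outside[OF vf_T] tv_const[OF vf_T])
  qed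
qed

lemma cov_lin:
  "\<omega> \<in> Tc p \<Longrightarrow> u \<in> T p \<Longrightarrow> v \<in> T p \<Longrightarrow> \<omega> (\<lambda>f. a * u f + b * v f) = a * \<omega> u + b * \<omega> v"
  and cov_outside: "\<omega> \<in> Tc p \<Longrightarrow> v \<notin> T p \<Longrightarrow> \<omega> v = 0"
  by (simp_all add: cotangent_space_def)

lemma covI:
  assumes "\<And>u v a b. u \<in> T p \<Longrightarrow> v \<in> T p \<Longrightarrow> \<omega> (\<lambda>f. a * u f + b * v f) = a * \<omega> u + b * \<omega> v"
    and "\<And>v. v \<notin> T p \<Longrightarrow> \<omega> v = 0"
  shows "\<omega> \<in> Tc p"
  using assms by (simp add: cotangent_space_def)

lemma cov_zero: "\<omega> \<in> Tc p \<Longrightarrow> \<omega> (\<lambda>f. 0) = 0"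
  using cov_lin[OF _ tv_zero tv_zero, of \<omega> p 0 0] by simp

lemma cov_scale: "\<omega> \<in> Tc p \<Longrightarrow> u \<in> T p \<Longrightarrow> \<omega> (\<lambda>f. a * u f) = a * \<omega> u"
  using cov_lin[of \<omega> p u u a 0] by simp

lemma tv_combination_sum:
  assumes "\<And>i. i \<in> I \<Longrightarrow> u i \<in> T p"
  shows "(\<lambda>f. \<Sum>i\<in>I. c i * u i f) \<in> T p"
  using assms
proof (induction I rule: infinite_finite_induct)
  case (insert i I)
  then show ?case using tv_combination[of "u i" p "\<lambda>f. \<Sum>i\<in>I. c i * u i f" "c i" 1] by simp
qed (auto simp: tv_zero)

lemma cov_sum:
  assumes "\<omega> \<in> Tc p" "\<And>i. i \<in> I \<Longrightarrow> u i \<in> T p"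
  shows "\<omega> (\<lambda>f. \<Sum>i\<in>I. c i * u i f) = (\<Sum>i\<in>I. c i * \<omega> (u i))"
  using assms(2)
proof (induction I rule: infinite_finite_induct)
  case (insert i I)
  then show ?case
    using cov_lin[OF assms(1), of "u i" "\<lambda>f. \<Sum>i\<in>I. c i * u i f" "c i" 1] tv_combination_sum[of I u p c]
    by simp
qed (simp_all add: cov_zero[OF assms(1)])

lemma cov_combination:
  assumes "\<omega> \<in> Tc p" "\<theta> \<in> Tc p"
  shows "(\<lambda>v. a * \<omega> v + b * \<theta> v) \<in> Tc p"
  by (rule covI) (simp_all add: cov_lin[OF assms(1)] cov_lin[OF assms(2)]
      cov_outside[OF assms(1)] cov_outside[OF assms(2)] algebra_simps)

lemma form_cov: "\<alpha> \<in> Om \<Longrightarrow> \<alpha> p \<in> Tc p"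
  and form_fun: "\<alpha> \<in> Om \<Longrightarrow> X \<in> VF \<Longrightarrow> (\<lambda>p. \<alpha> p (X p)) \<in> C"
  by (simp_all add: one_forms_def)

lemma form_combination:
  assumes "\<alpha> \<in> Om" "\<beta> \<in> Om" "u \<in> C" "w \<in> C"
  shows "(\<lambda>p v. u p * \<alpha> p v + w p * \<beta> p v) \<in> Om"
  using assms unfolding one_forms_def by (auto intro!: cov_combination smooth_fun_intros)

lemma form_scale: "\<alpha> \<in> Om \<Longrightarrow> u \<in> C \<Longrightarrow> (\<lambda>p v. u p * \<alpha> p v) \<in> Om"
  using form_combination[of \<alpha> \<alpha> u "\<lambda>_. 0"] by (simp add: smooth_fun_const)

lemma d_apply: "v \<in> T p \<Longrightarrow> d f p v = v f"
  by (simp add: differential_def)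

lemma d_form: "f \<in> C \<Longrightarrow> d f \<in> Om"
  unfolding one_forms_def mem_Collect_eq
  by (intro conjI allI ballI covI) (auto simp: differential_def tv_combination vf_T vf_fun)

lemma d_cov: "f \<in> C \<Longrightarrow> d f p \<in> Tc p"
  by (rule form_cov[OF d_form])

lemma d_mult:
  assumes "f \<in> C" "g \<in> C"
  shows "d (\<lambda>x. f x * g x) p = (\<lambda>v. f p * d g p v + g p * d f p v)"
proof
  show "d (\<lambda>x. f x * g x) p v = f p * d g p v + g p * d f p v" for v
    by (cases "v \<in> T p") (simp_all add: differential_def tv_mult[OF _ assms])
qed

lemma d_sum:
  assumes "\<And>i. i \<in> I \<Longrightarrow> f i \<in> C"
  shows "d (\<lambda>x. \<Sum>i\<in>I. c i * f i x) p = (\<lambda>v. \<Sum>i\<in>I. c i * d (f i) p v)"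
proof
  show "d (\<lambda>x. \<Sum>i\<in>I. c i * f i x) p v = (\<Sum>i\<in>I. c i * d (f i) p v)" for v
  proof (cases "v \<in> T p")
    case True
    then show ?thesis
      using tv_sum[OF True, of I "\<lambda>i x. c i * f i x"] tv_cmult[OF True] assms
      by (simp add: d_apply smooth_fun_cmult)
  qed (simp add: differential_def)
qed

section \<open>Expansion of vectors and 1-forms in a frame\<close>

lemma frame_vector:
  assumes "frame_at p B \<eta> x E" "v \<in> T q"
  shows "(\<lambda>f. \<eta> q * v f) = (\<lambda>f. \<Sum>b\<in>B. v (x b) * E b q f)"
proof
  fix f
  have E: "E b q \<in> T q" for b using assms(1) by (simp add: frame_at_def vf_T)
  show "\<eta> q * v f = (\<Sum>b\<in>B. v (x b) * E b q f)"
  proof (cases "f \<in> C")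
    case True
    then show ?thesis using assms unfolding frame_at_def by simp
  next
    case False
    then show ?thesis using tv_outside[OF assms(2)] tv_outside[OF E] by simp
  qed
qed

lemma frame_vector_at:
  assumes "frame_at p B \<eta> x E" "v \<in> T p"
  shows "(\<lambda>f. \<Sum>b\<in>B. v (x b) * E b p f) = v"
proof -
  have \<eta>: "\<eta> p = 1" using assms(1) by (simp add: frame_at_def)
  show ?thesis using frame_vector[OF assms] unfolding \<eta> mult_1 by (rule sym)
qed

text \<open>Dual to \<open>frame_vector\<close>. It is an identity of global forms, so operators
  such as the bracket can be applied to it.\<close>

lemma frame_form:
  assumes fr: "frame_at p B \<eta> x E" and \<alpha>: "\<alpha> \<in> Om"
  shows "(\<lambda>q v. \<eta> q * \<alpha> q v) = (\<lambda>q v. \<Sum>b\<in>B. \<alpha> q (E b q) * d (x b) q v)"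
proof (intro ext)
  fix q v
  have E: "E b q \<in> T q" for b using fr by (simp add: frame_at_def vf_T)
  show "\<eta> q * \<alpha> q v = (\<Sum>b\<in>B. \<alpha> q (E b q) * d (x b) q v)"
  proof (cases "v \<in> T q")
    case True
    then have "\<eta> q * \<alpha> q v = \<alpha> q (\<lambda>f. \<Sum>b\<in>B. v (x b) * E b q f)"
      using frame_vector[OF fr True] cov_scale[OF form_cov[OF \<alpha>] True, of "\<eta> q"] by simp
    then show ?thesis
      using cov_sum[OF form_cov[OF \<alpha>] E] by (simp add: d_apply True mult.commute)
  next
    case False
    then show ?thesis by (simp add: cov_outside[OF form_cov[OF \<alpha>]] differential_def)
  qed
qed

text \<open>The frame coordinates with constant coefficients \<omega> (E b p) give a primitive that
  works at the single point p. Pointwise claims about the anchor thereby reduce to the bracket of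
  functions.\<close>

lemma covector_exact:
  assumes \<omega>: "\<omega> \<in> Tc p"
  shows "\<exists>h\<in>C. \<omega> = d h p"
proof -
  obtain B \<eta> x E where fr: "frame_at p B \<eta> x E" using frame_exists by blast
  have E: "E b p \<in> T p" and x: "x b \<in> C" for b
    using fr by (simp_all add: frame_at_def vf_T)
  have "\<omega> v = d (\<lambda>q. \<Sum>b\<in>B. \<omega> (E b p) * x b q) p v" for v
  proof (cases "v \<in> T p")
    case True
    then have "\<omega> v = \<omega> (\<lambda>f. \<Sum>b\<in>B. v (x b) * E b p f)"
      by (simp only: frame_vector_at[OF fr True])
    also have "\<dots> = (\<Sum>b\<in>B. v (x b) * \<omega> (E b p))"
      by (rule cov_sum[OF \<omega> E])
    also have "\<dots> = d (\<lambda>q. \<Sum>b\<in>B. \<omega> (E b p) * x b q) p v"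
      by (subst d_sum[OF x]) (simp add: d_apply True mult.commute)
    finally show ?thesis .
  next
    case False
    then show ?thesis by (simp add: cov_outside[OF \<omega>] differential_def)
  qed
  then have "\<omega> = d (\<lambda>q. \<Sum>b\<in>B. \<omega> (E b p) * x b q) p" by (rule ext)
  then show ?thesis using x by (intro bexI[of _ "\<lambda>q. \<Sum>b\<in>B. \<omega> (E b p) * x b q"])
      (auto intro!: smooth_fun_sum smooth_fun_cmult)
qed

lemma vector_extension:
  assumes v: "v \<in> T p"
  shows "\<exists>Y\<in>VF. Y p = v"
proof -
  obtain B \<eta> x E where fr: "frame_at p B \<eta> x E" using frame_exists by blast
  have E: "E b \<in> VF" for b
    using fr by (simp add: frame_at_def)
  show ?thesis
    by (intro bexI[of _ "\<lambda>q f. \<Sum>b\<in>B. v (x b) * E b q f"])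
      (simp_all only: frame_vector_at[OF fr v] vf_sum[OF E])
qed

text \<open>Since \<eta> p = 1, \<Phi> takes the same value on \<alpha> as on \<eta> \<alpha>, and
  the latter is a global combination of the exact forms d (x b). Hence \<Phi> is determined by its
  values on exact forms.\<close>

lemma tensorial_expand:
  assumes fr: "frame_at p B \<eta> x E"
    and lin: "\<And>u w \<alpha> \<beta>. u \<in> C \<Longrightarrow> w \<in> C \<Longrightarrow> \<alpha> \<in> Om \<Longrightarrow> \<beta> \<in> Om \<Longrightarrow>
      \<Phi> (\<lambda>q v. u q * \<alpha> q v + w q * \<beta> q v) = u p * \<Phi> \<alpha> + w p * (\<Phi> \<beta> :: real)"
    and \<alpha>: "\<alpha> \<in> Om"
  shows "\<Phi> \<alpha> = (\<Sum>b\<in>B. \<alpha> p (E b p) * \<Phi> (d (x b)))"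
proof -
  have E: "E b \<in> VF" and x: "x b \<in> C" and \<eta>: "\<eta> \<in> C" "\<eta> p = 1" for b
    using fr by (simp_all add: frame_at_def)
  have zero: "\<Phi> (\<lambda>q v. 0) = 0"
    using lin[of "\<lambda>_. 0" "\<lambda>_. 0" \<alpha> \<alpha>] \<alpha> by (simp add: smooth_fun_const)
  have sum: "(\<lambda>q v. \<Sum>b\<in>I. \<alpha> q (E b q) * d (x b) q v) \<in> Om \<and>
    \<Phi> (\<lambda>q v. \<Sum>b\<in>I. \<alpha> q (E b q) * d (x b) q v) = (\<Sum>b\<in>I. \<alpha> p (E b p) * \<Phi> (d (x b)))" for I
  proof (induction I rule: infinite_finite_induct)
    case (insert i I)
    let ?S = "\<lambda>q v. \<Sum>b\<in>I. \<alpha> q (E b q) * d (x b) q v"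
    have S: "?S \<in> Om" using insert.IH by (rule conjunct1)
    note c = form_fun[OF \<alpha> E[of i]] and one = smooth_fun_const[of 1] and dx = d_form[OF x[of i]]
    show ?case
      using lin[OF c one dx S] form_combination[OF dx S c one] insert by simp
  next
    case empty
    then show ?case
      using form_combination[OF \<alpha> \<alpha>, of "\<lambda>_. 0" "\<lambda>_. 0"] by (simp add: zero smooth_fun_const)
  next
    case (infinite I)
    then show ?case
      using form_combination[OF \<alpha> \<alpha>, of "\<lambda>_. 0" "\<lambda>_. 0"] by (simp add: zero smooth_fun_const)
  qed
  have "\<Phi> \<alpha> = \<Phi> (\<lambda>q v. \<eta> q * \<alpha> q v)"
    using lin[of \<eta> "\<lambda>_. 0" \<alpha> \<alpha>] \<alpha> \<eta> by (simp add: smooth_fun_const)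
  then show ?thesis using sum[of B] by (simp add: frame_form[OF fr \<alpha>])
qed

end


section \<open>Lie algebroid structures on the cotangent bundle\<close>

locale cotangent_algebroid = smooth_mfd A
  for A :: "('a::{t2_space,second_countable_topology}, 'e::{real_inner,banach}) atlas" +
  fixes br :: "('a \<Rightarrow> 'a covec) \<Rightarrow> ('a \<Rightarrow> 'a covec) \<Rightarrow> ('a \<Rightarrow> 'a covec)"
    and \<rho> :: "'a \<Rightarrow> 'a covec \<Rightarrow> 'a tvec"
  assumes algebroid: "cotangent_lie_algebroid A br \<rho>"
begin

lemmas algebroid_axioms = algebroid[unfolded cotangent_lie_algebroid_def]

lemmas anchor_T = algebroid_axioms[THEN conjunct1, rule_format]
  and anchor_lin = algebroid_axioms[THEN conjunct2, THEN conjunct1, rule_format]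
  and anchor_VF = algebroid_axioms[THEN conjunct2, THEN conjunct2, THEN conjunct1, rule_format]

lemmas bracket_axioms = algebroid_axioms[THEN conjunct2, THEN conjunct2, THEN conjunct2]

lemmas br_form = bracket_axioms[THEN conjunct1, rule_format]
  and br_lin_left = bracket_axioms[THEN conjunct2, THEN conjunct1, rule_format]
  and br_skew = bracket_axioms[THEN conjunct2, THEN conjunct2, THEN conjunct1, rule_format]
  and br_anchor = bracket_axioms[THEN conjunct2, THEN conjunct2, THEN conjunct2, THEN conjunct2,
    THEN conjunct1, rule_format]
  and br_Leibniz = bracket_axioms[THEN conjunct2, THEN conjunct2, THEN conjunct2, THEN conjunct2,
    THEN conjunct2, rule_format]

definition pb :: "('a \<Rightarrow> real) \<Rightarrow> ('a \<Rightarrow> real) \<Rightarrow> 'a \<Rightarrow> real" where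
  "pb f g p = \<rho> p (d f p) g"

lemma pb_T: "f \<in> C \<Longrightarrow> (\<lambda>g. pb f g p) \<in> T p"
  unfolding pb_def by (rule anchor_T[OF d_cov])

lemma pb_fun: "f \<in> C \<Longrightarrow> g \<in> C \<Longrightarrow> pb f g \<in> C"
  unfolding pb_def[abs_def] by (rule vf_fun[OF anchor_VF[OF d_form]])

lemma pb_mult_right:
  "f \<in> C \<Longrightarrow> g \<in> C \<Longrightarrow> h \<in> C \<Longrightarrow> pb f (\<lambda>x. g x * h x) p = g p * pb f h p + pb f g p * h p"
  by (rule tv_mult[OF pb_T])

lemma pb_add_right:
  "f \<in> C \<Longrightarrow> g \<in> C \<Longrightarrow> h \<in> C \<Longrightarrow> pb f (\<lambda>x. g x + h x) p = pb f g p + pb f h p"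
  by (rule tv_add[OF pb_T])

lemma pb_mult_left:
  assumes "f \<in> C" "g \<in> C"
  shows "pb (\<lambda>x. f x * g x) h p = f p * pb g h p + g p * pb f h p"
  unfolding pb_def d_mult[OF assms] anchor_lin[OF d_cov[OF assms(2)] d_cov[OF assms(1)]] ..

text \<open>Additivity is an axiom in the left slot only; skewness moves it to the right, and the
  Leibniz rule then handles the coefficients.\<close>

lemma br_combination_right:
  assumes "\<alpha> \<in> Om" "\<beta> \<in> Om" "\<gamma> \<in> Om" "u \<in> C" "w \<in> C"
  shows "br \<alpha> (\<lambda>p v. u p * \<beta> p v + w p * \<gamma> p v) p v =
    u p * br \<alpha> \<beta> p v + \<rho> p (\<alpha> p) u * \<beta> p v + (w p * br \<alpha> \<gamma> p v + \<rho> p (\<alpha> p) w * \<gamma> p v)"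
proof -
  let ?b = "\<lambda>p v. u p * \<beta> p v" and ?c = "\<lambda>p v. w p * \<gamma> p v"
  have b: "?b \<in> Om" and c: "?c \<in> Om" by (auto intro!: form_scale assms)
  have bc: "(\<lambda>p v. ?b p v + ?c p v) \<in> Om" by (rule form_combination[OF assms(2-5)])
  have "br \<alpha> (\<lambda>p v. ?b p v + ?c p v) p v = - br (\<lambda>p v. 1 * ?b p v + 1 * ?c p v) \<alpha> p v"
    by (subst br_skew[OF assms(1) bc]) simp
  also have "\<dots> = - br ?b \<alpha> p v - br ?c \<alpha> p v"
    by (subst br_lin_left[OF b c assms(1)]) simp
  also have "\<dots> = br \<alpha> ?b p v + br \<alpha> ?c p v"
    by (subst (3 4) br_skew) (simp_all add: b c assms)
  finally show ?thesis
    unfolding br_Leibniz[OF assms(1,2,4)] br_Leibniz[OF assms(1,3,5)] .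
qed

text \<open>The value of $d_*X$ on $df$ and $dg$.\<close>

definition ce :: "('a \<Rightarrow> 'a tvec) \<Rightarrow> ('a \<Rightarrow> real) \<Rightarrow> ('a \<Rightarrow> real) \<Rightarrow> 'a \<Rightarrow> real" where
  "ce X f g p = pb f (\<lambda>q. X q g) p - pb g (\<lambda>q. X q f) p - br (d f) (d g) p (X p)"

lemma ce_differential_field:
  assumes "f \<in> C" "g \<in> C"
  shows "ce_differential A br \<rho> 1 (mv_field X) p [f, g] = ce X f g p"
  using assms
  by (simp add: ce_differential_def ce_def pb_def lessThan_Suc drop_index_def mv_field_def)

lemma br_d_skew: "f \<in> C \<Longrightarrow> g \<in> C \<Longrightarrow> br (d g) (d f) p v = - br (d f) (d g) p v"
  using br_skew[OF d_form d_form, of g f] by simp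

lemma ce_skew: "f \<in> C \<Longrightarrow> g \<in> C \<Longrightarrow> ce X g f p = - ce X f g p"
  unfolding ce_def by (subst br_d_skew) simp_all

lemma ce_fun:
  assumes X: "X \<in> VF" and f: "f \<in> C" and g: "g \<in> C"
  shows "ce X f g \<in> C"
  unfolding ce_def[abs_def]
  by (rule smooth_fun_diff[OF smooth_fun_diff[OF pb_fun[OF f vf_fun[OF X g]] pb_fun[OF g vf_fun[OF X f]]]
        form_fun[OF br_form[OF d_form[OF f] d_form[OF g]] X]])

text \<open>The terms {f,h} X(k) and {f,k} X(h) of the first summand cancel against the anchor terms
  in the Leibniz rule of the bracket; so d_*X is a derivation in this argument.\<close>

lemma ce_mult:
  assumes "X \<in> VF" "f \<in> C" "h \<in> C" "k \<in> C"
  shows "ce X f (\<lambda>x. h x * k x) p = h p * ce X f k p + k p * ce X f h p"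
proof -
  have X: "X p \<in> T p" and Xh: "(\<lambda>q. X q h) \<in> C" and Xk: "(\<lambda>q. X q k) \<in> C"
    using assms vf_T vf_fun by auto
  have "d (\<lambda>x. h x * k x) = (\<lambda>q v. h q * d k q v + k q * d h q v)"
    using d_mult[OF assms(3,4)] by (intro ext) simp
  then have b: "br (d f) (d (\<lambda>x. h x * k x)) p (X p) =
      h p * br (d f) (d k) p (X p) + pb f h p * X p k + (k p * br (d f) (d h) p (X p) + pb f k p * X p h)"
    using br_combination_right[OF d_form d_form d_form, of f k h h k p "X p"] assms X
    by (simp add: pb_def d_apply)
  have "(\<lambda>q. X q (\<lambda>x. h x * k x)) = (\<lambda>q. h q * X q k + X q h * k q)"
    using tv_mult[OF vf_T[OF assms(1)] assms(3,4)] by simp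
  then show ?thesis
    unfolding ce_def b
    by (simp add: pb_mult_left pb_add_right pb_mult_right assms Xh Xk smooth_fun_mult algebra_simps)
qed

text \<open>This is d_*(uX) = u d_*X + d_*u \<and> X, summed for two fields, where (d_*u)(f) is
  \<open>pb f u\<close>. Two fields are needed for the expansion of [X, hY].\<close>

lemma ce_combination:
  assumes "X \<in> VF" "Y \<in> VF" "u \<in> C" "w \<in> C" "f \<in> C" "g \<in> C"
  shows "ce (\<lambda>p f. u p * X p f + w p * Y p f) f g p =
    u p * ce X f g p + pb f u p * X p g - pb g u p * X p f +
    (w p * ce Y f g p + pb f w p * Y p g - pb g w p * Y p f)"
proof -
  have "br (d f) (d g) p (\<lambda>f. u p * X p f + w p * Y p f) =
      u p * br (d f) (d g) p (X p) + w p * br (d f) (d g) p (Y p)"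
    by (rule cov_lin[OF form_cov[OF br_form[OF d_form d_form]] vf_T vf_T]) (rule assms)+
  then show ?thesis
    unfolding ce_def
    by (simp add: pb_add_right pb_mult_right assms vf_fun smooth_fun_mult algebra_simps)
qed

lemma ce_scale:
  assumes "X \<in> VF" "u \<in> C" "f \<in> C" "g \<in> C"
  shows "ce (\<lambda>p f. u p * X p f) f g p = u p * ce X f g p + pb f u p * X p g - pb g u p * X p f"
proof -
  have "pb f (\<lambda>_. 0) p = 0" if "f \<in> C" for f by (rule tv_const[OF pb_T[OF that]])
  then show ?thesis
    using ce_combination[OF assms(1,1,2) smooth_fun_const assms(3,4), of 0 p] assms by simp
qed

end

section \<open>The Schouten bracket in low degrees\<close>

lemma sum_permutes_2:
  "(\<Sum>\<sigma> | \<sigma> permutes {..<2::nat}. h \<sigma>) = h id + h (Transposition.transpose 0 1)"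
proof -
  have "{..<2::nat} = insert 0 {1}" by auto
  then show ?thesis
    by (simp add: sum_over_permutations_insert permutes_sing)
qed

lemma sum_permutes_3:
  "(\<Sum>\<sigma> | \<sigma> permutes {..<3::nat}. h \<sigma>) =
     h id + h (Transposition.transpose 1 2) + (h (Transposition.transpose 0 1) + h (Transposition.transpose 0 1 \<circ> Transposition.transpose 1 2)
     + (h (Transposition.transpose 0 2) + h (Transposition.transpose 0 2 \<circ> Transposition.transpose 1 2)))"
proof -
  have "{..<3::nat} = insert 0 (insert 1 {2})" by auto
  then show ?thesis
    by (simp add: sum_over_permutations_insert permutes_sing)
qed

text \<open>The unevaluated bounds are those that appear when \<open>mv_insert\<close> is unfolded
  for the degrees in question.\<close>

lemma map_upt_simps:
  "map (\<lambda>i. fs ! \<sigma> i) [0..<2 - 1] = [fs ! \<sigma> 0]"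
  "map (\<lambda>i. fs ! \<sigma> i) [2 - 1..<2 + 1 - 1] = [fs ! \<sigma> (1::nat)]"
  "map (\<lambda>i. fs ! \<sigma> i) [0..<1 - 1] = []"
  "map (\<lambda>i. fs ! \<sigma> i) [1 - 1..<1 + 2 - 1] = [fs ! \<sigma> 0, fs ! \<sigma> 1]"
  "map (\<lambda>i. fs ! \<sigma> i) [2 - 1..<2 + 2 - 1] = [fs ! \<sigma> 1, fs ! \<sigma> 2]"
  by (simp_all add: upt_rec numeral_2_eq_2)

lemma mv_insert_2_1:
  "mv_insert 2 1 P (mv_field Y) p [f, g] = P p [f, \<lambda>q. Y q g] - P p [g, \<lambda>q. Y q f]"
proof -
  have n: "2 + 1 - 1 = (2::nat)" by simp
  show ?thesis
    unfolding mv_insert_def map_upt_simps unfolding n sum_permutes_2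
    by (simp add: sign_swap_id mv_field_def)
qed

text \<open>P is not assumed alternating, so both orders appear, divided by
  \<open>fact 0 * fact 2\<close>.\<close>

lemma mv_insert_1_2:
  "mv_insert 1 2 (mv_field Y) P p [f, g] = (Y p (\<lambda>q. P q [f, g]) - Y p (\<lambda>q. P q [g, f])) / 2"
proof -
  have n: "1 + 2 - 1 = (2::nat)" by simp
  show ?thesis
    unfolding mv_insert_def map_upt_simps unfolding n sum_permutes_2
    by (simp add: sign_swap_id mv_field_def)
qed

text \<open>For an alternating P the six terms pair up into the Jacobiator, the denominator being
  \<open>fact 1 * fact 2\<close>.\<close>

lemma mv_insert_2_2:
  "mv_insert 2 2 P P p [f, g, h] =
    (P p [f, \<lambda>q. P q [g, h]] - P p [f, \<lambda>q. P q [h, g]] + P p [g, \<lambda>q. P q [h, f]]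
    - P p [g, \<lambda>q. P q [f, h]] + P p [h, \<lambda>q. P q [f, g]] - P p [h, \<lambda>q. P q [g, f]]) / 2"
proof -
  have n: "2 + 2 - 1 = (3::nat)" by simp
  have 2: "[f, g, h] ! 2 = h" by (simp add: numeral_2_eq_2)
  show ?thesis
    unfolding mv_insert_def map_upt_simps unfolding n sum_permutes_3
    by (simp add: sign_swap_id sign_compose permutation_swap_id Transposition.transpose_def 2 del: nth_Cons_numeral)
qed

section \<open>Lie bialgebroids\<close>

locale bialgebroid = cotangent_algebroid A br \<rho>
  for A :: "('a::{t2_space,second_countable_topology}, 'e::{real_inner,banach}) atlas"
    and br :: "('a \<Rightarrow> 'a covec) \<Rightarrow> ('a \<Rightarrow> 'a covec) \<Rightarrow> ('a \<Rightarrow> 'a covec)"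
    and \<rho> :: "'a \<Rightarrow> 'a covec \<Rightarrow> 'a tvec" +
  assumes bialgebroid: "lie_bialgebroid A br \<rho>"
    and compatible: "dim (UNIV :: 'e set) = 1 \<Longrightarrow> compatible_on_functions A br \<rho>"
begin

text \<open>The bialgebroid condition evaluated on df and dg. In both Schouten brackets the sign
  exponent is 6, so the second insertion enters with a minus.\<close>

lemma ce_lie_bracket:
  assumes X: "X \<in> VF" and Y: "Y \<in> VF" and f: "f \<in> C" and g: "g \<in> C"
  shows "ce (lie_bracket X Y) f g p =
    ce X f (\<lambda>q. Y q g) p + ce X (\<lambda>q. Y q f) g p - Y p (ce X f g) +
    X p (ce Y f g) - ce Y f (\<lambda>q. X q g) p - ce Y (\<lambda>q. X q f) g p"
proof -
  let ?D = "\<lambda>X. ce_differential A br \<rho> 1 (mv_field X)"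
  have "?D (lie_bracket X Y) = (\<lambda>p fs. schouten 2 1 (?D X) (mv_field Y) p fs + schouten 1 2 (mv_field X) (?D Y) p fs)"
    using bialgebroid X Y unfolding lie_bialgebroid_def by blast
  then have eq: "?D (lie_bracket X Y) p [f, g] =
      schouten 2 1 (?D X) (mv_field Y) p [f, g] + schouten 1 2 (mv_field X) (?D Y) p [f, g]"
    by simp
  \<comment> \<open>Skewness of \<open>ce\<close> makes the two halves in
    \<open>mv_insert_1_2\<close> equal.\<close>
  have half: "(Z p (\<lambda>q. ?D W q [f, g]) - Z p (\<lambda>q. ?D W q [g, f])) / 2 = Z p (ce W f g)"
    if Z: "Z \<in> VF" and W: "W \<in> VF" for Z W
  proof -
    have "(\<lambda>q. ?D W q [f, g]) = ce W f g" "(\<lambda>q. ?D W q [g, f]) = (\<lambda>q. - ce W f g q)"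
      using ce_differential_field[OF f g] ce_differential_field[OF g f] ce_skew[OF f g] by auto
    then show ?thesis using tv_uminus[OF vf_T[OF Z] ce_fun[OF W f g]] by simp
  qed
  have "schouten 2 1 (?D X) (mv_field Y) p [f, g] =
      ce X f (\<lambda>q. Y q g) p + ce X (\<lambda>q. Y q f) g p - Y p (ce X f g)"
    unfolding schouten_def mv_insert_2_1 mv_insert_1_2 half[OF Y X]
      ce_differential_field[OF f vf_fun[OF Y g]] ce_differential_field[OF g vf_fun[OF Y f]]
      ce_skew[OF vf_fun[OF Y f] g] by simp
  moreover have "schouten 1 2 (mv_field X) (?D Y) p [f, g] =
      X p (ce Y f g) - (ce Y f (\<lambda>q. X q g) p + ce Y (\<lambda>q. X q f) g p)"
    unfolding schouten_def mv_insert_2_1 mv_insert_1_2 half[OF X Y]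
      ce_differential_field[OF f vf_fun[OF X g]] ce_differential_field[OF g vf_fun[OF X f]]
      ce_skew[OF vf_fun[OF X f] g] by simp
  ultimately show ?thesis using eq by (simp add: ce_differential_field[OF f g] del: One_nat_def)
qed

text \<open>Replacing $Y$ by $hY$ in the compatibility condition gives $W\wedge Y = 0$ for the vector field
  $W = d_*(Xh) - [X, d_*h] + i_{dh}d_*X$. This is $W(f)$, in which $\{f, Xh\}$ has cancelled.\<close>

definition defect :: "('a \<Rightarrow> 'a tvec) \<Rightarrow> ('a \<Rightarrow> real) \<Rightarrow> ('a \<Rightarrow> real) \<Rightarrow> 'a \<Rightarrow> real" where
  "defect X h f p = pb h (\<lambda>q. X q f) p + pb (\<lambda>q. X q f) h p + br (d f) (d h) p (X p) - X p (pb f h)"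

lemma defect_wedge:
  assumes X: "X \<in> VF" and Y: "Y \<in> VF" and h: "h \<in> C" and f: "f \<in> C" and g: "g \<in> C"
  shows "defect X h f p * Y p g = defect X h g p * Y p f"
proof -
  let ?Z = "\<lambda>p f. h p * Y p f"
  have Z: "?Z \<in> VF" by (rule vf_scale[OF Y h])
  have Xh: "(\<lambda>q. X q h) \<in> C" and Xf: "(\<lambda>q. X q f) \<in> C" and Xg: "(\<lambda>q. X q g) \<in> C"
    and Yf: "(\<lambda>q. Y q f) \<in> C" and Yg: "(\<lambda>q. Y q g) \<in> C"
    using X Y f g h vf_fun by auto
  note XY = vf_lie_bracket[OF X Y]
  have l: "ce (lie_bracket X ?Z) f g p =
      X p h * ce Y f g p + pb f (\<lambda>q. X q h) p * Y p g - pb g (\<lambda>q. X q h) p * Y p f +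
      (h p * ce (lie_bracket X Y) f g p + pb f h p * lie_bracket X Y p g - pb g h p * lie_bracket X Y p f)"
    unfolding lie_bracket_scale_right[OF X Y h] by (rule ce_combination[OF Y XY Xh h f g])
  have r1: "ce X f (\<lambda>q. ?Z q g) p = h p * ce X f (\<lambda>q. Y q g) p + Y p g * ce X f h p"
    by (rule ce_mult[OF X f h Yg])
  have r2: "ce X (\<lambda>q. ?Z q f) g p = h p * ce X (\<lambda>q. Y q f) g p - Y p f * ce X g h p"
    using ce_mult[OF X g h Yf, of p] ce_skew[OF g smooth_fun_mult[OF h Yf], of X p] ce_skew[OF g Yf, of X p]
    by (simp add: algebra_simps)
  have r4: "X p (ce ?Z f g) =
      h p * X p (ce Y f g) + X p h * ce Y f g p + pb f h p * X p (\<lambda>q. Y q g) + X p (pb f h) * Y p g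
      - (pb g h p * X p (\<lambda>q. Y q f) + X p (pb g h) * Y p f)"
  proof -
    have "ce ?Z f g = (\<lambda>q. h q * ce Y f g q + pb f h q * Y q g - pb g h q * Y q f)"
      by (intro ext ce_scale[OF Y h f g])
    then show ?thesis
      using ce_fun[OF Y f g] pb_fun[OF f h] pb_fun[OF g h] h Yf Yg
      by (simp add: tv_diff[OF vf_T[OF X]] tv_add[OF vf_T[OF X]] tv_mult[OF vf_T[OF X]]
          smooth_fun_add smooth_fun_mult)
  qed
  have r5: "ce ?Z f (\<lambda>q. X q g) p = h p * ce Y f (\<lambda>q. X q g) p + pb f h p * Y p (\<lambda>q. X q g)
      - pb (\<lambda>q. X q g) h p * Y p f"
    by (rule ce_scale[OF Y h f Xg])
  have r6: "ce ?Z (\<lambda>q. X q f) g p = h p * ce Y (\<lambda>q. X q f) g p + pb (\<lambda>q. X q f) h p * Y p g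
      - pb g h p * Y p (\<lambda>q. X q f)"
    by (rule ce_scale[OF Y h Xf g])
  have c: "h p * ce (lie_bracket X Y) f g p =
    h p * (ce X f (\<lambda>q. Y q g) p + ce X (\<lambda>q. Y q f) g p - Y p (ce X f g) +
      X p (ce Y f g) - ce Y f (\<lambda>q. X q g) p - ce Y (\<lambda>q. X q f) g p)"
    by (simp only: ce_lie_bracket[OF X Y f g])
  \<comment> \<open>Fact \<open>c\<close> removes h times the condition for X and Y. The terms with
    X(h) d_*Y cancel, and so do those with {f,h} or {g,h} times [X,Y]; in what is left, Y appears
    only through the values Y p f and Y p g.\<close>
  have "(pb f (\<lambda>q. X q h) p - ce X f h p - X p (pb f h) + pb (\<lambda>q. X q f) h p) * Y p g =
      (pb g (\<lambda>q. X q h) p - ce X g h p - X p (pb g h) + pb (\<lambda>q. X q g) h p) * Y p f"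
    using ce_lie_bracket[OF X Z f g, of p] c unfolding l r1 r2 r4 r5 r6
    by (simp add: lie_bracket_def algebra_simps)
  then show ?thesis by (simp add: defect_def ce_def algebra_simps)
qed

lemma defect_zero:
  assumes dim: "dim (UNIV :: 'e set) \<noteq> 1" and X: "X \<in> VF" and h: "h \<in> C" and f: "f \<in> C"
  shows "defect X h f p = 0"
proof -
  obtain B \<eta> x E where fr: "frame_at p B \<eta> x E" using frame_exists by blast
  have fin: "finite B" and card: "card B \<noteq> 1" and x: "\<And>b. x b \<in> C" and E: "\<And>b. E b \<in> VF"
    and \<delta>: "\<And>b c. b \<in> B \<Longrightarrow> c \<in> B \<Longrightarrow> E b p (x c) = (if b = c then 1 else 0)"
    using fr dim by (simp_all add: frame_at_def)
  have Xf: "(\<lambda>q. X q f) \<in> C" by (rule vf_fun[OF X f])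
  show ?thesis
  proof (cases "B = {}")
    case True
    \<comment> \<open>An empty frame means dimension 0: there are no nonzero tangent vectors, and
      each term of the defect vanishes.\<close>
    have z: "v = (\<lambda>f. 0)" if "v \<in> T p" for v
      using frame_vector_at[OF fr that] True by simp
    have "pb u w p = 0" if "u \<in> C" for u w
      using z[OF pb_T[OF that]] by metis
    moreover have "br (d f) (d h) p (X p) = 0"
      using z[OF vf_T[OF X]] cov_zero[OF form_cov[OF br_form[OF d_form[OF f] d_form[OF h]]]] by simp
    moreover have "X p (pb f h) = 0" using z[OF vf_T[OF X]] by metis
    ultimately show ?thesis by (simp add: defect_def h Xf)
  next
    case False
    then obtain b where b: "b \<in> B" by blast
    moreover have "B \<noteq> {b}" using card by auto
    ultimately obtain c where c: "c \<in> B" "c \<noteq> b" by blast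
    \<comment> \<open>Either E b already kills f at p, or the combination of E b and E c with
      coefficients taken from their values on f does; in the latter case x c detects it, with the
      value E b p f.\<close>
    have "\<exists>Y\<in>VF. \<exists>g\<in>C. Y p f = 0 \<and> Y p g \<noteq> 0"
    proof (cases "E b p f = 0")
      case True
      then show ?thesis using E x \<delta>[OF b b] by (intro bexI[of _ "E b"] bexI[of _ "x b"]) auto
    next
      case False
      let ?Y = "\<lambda>q g. E b p f * E c q g + (- E c p f) * E b q g"
      have "?Y \<in> VF"
        using vf_combination[OF E[of c] E[of b] smooth_fun_const[of "E b p f"] smooth_fun_const[of "- E c p f"]] .
      moreover have "?Y p f = 0 \<and> ?Y p (x c) \<noteq> 0" using False \<delta> b c by simp
      ultimately show ?thesis by (intro bexI[of _ ?Y] bexI[of _ "x c"] x)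
    qed
    then obtain Y g where "Y \<in> VF" "g \<in> C" "Y p f = 0" "Y p g \<noteq> 0" by blast
    then show ?thesis using defect_wedge[OF X _ h f, of Y g p] by simp
  qed
qed

section \<open>Skewness of the bracket of functions, and the bracket of exact forms\<close>

lemma pb_skew:
  assumes f: "f \<in> C" and g: "g \<in> C"
  shows "pb f g p = - pb g f p"
proof (cases "dim (UNIV :: 'e set) = 1")
  case True
  \<comment> \<open>The brackets have degree 0, hence the empty list. The first one is (d_*f)(g) =
    {g,f}, the second is -(d_*g)(f) = -{f,g}.\<close>
  have "schouten 1 0 (ce_differential A br \<rho> 0 (mv_fun f)) (mv_fun g) p [] -
        schouten 0 1 (mv_fun f) (ce_differential A br \<rho> 0 (mv_fun g)) p [] = 0"
    using compatible[OF True] f g unfolding compatible_on_functions_def by simp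
  moreover have e: "ce_differential A br \<rho> 0 (mv_fun f) p [g] = pb g f p" if "g \<in> C" for f g
    using that by (simp add: ce_differential_def mv_fun_def drop_index_def pb_def)
  have i: "mv_insert 1 0 P Q p [] = P p [\<lambda>q. Q q []]" "mv_insert 0 1 (mv_fun f) P p [] = 0" for P Q f
    by (simp_all add: mv_insert_def mv_fun_def sign_id)
  ultimately show ?thesis
    using f g by (simp add: schouten_def i e mv_fun_def del: One_nat_def)
next
  case False
  show ?thesis
  proof (cases "\<exists>X\<in>VF. \<exists>h\<in>C. X p h \<noteq> 0")
    case True
    then obtain X h where X: "X \<in> VF" and h: "h \<in> C" and nz: "X p h \<noteq> 0" by blast
    \<comment> \<open>The defects of $fX$ and $X$ differ by the term $X(h)(\{g,f\} + \{f,g\})$.\<close>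
    let ?Y = "\<lambda>p k. f p * X p k"
    have Y: "?Y \<in> VF" by (rule vf_scale[OF X f])
    have Xh: "(\<lambda>q. X q h) \<in> C" by (rule vf_fun[OF X h])
    have "br (d h) (d g) p (?Y p) = f p * br (d h) (d g) p (X p)"
      by (rule cov_scale[OF form_cov[OF br_form[OF d_form[OF h] d_form[OF g]]] vf_T[OF X]])
    then have "defect ?Y g h p = f p * defect X g h p + X p h * (pb g f p + pb f g p)"
      by (simp add: defect_def pb_mult_right[OF g f Xh] pb_mult_left[OF f Xh] algebra_simps)
    then have "X p h * (pb g f p + pb f g p) = 0"
      by (simp add: defect_zero[OF False X g h] defect_zero[OF False Y g h])
    with nz show ?thesis by simp
  next
    case False
    \<comment> \<open>If no field moves a function at p, then no tangent vector at p does, since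
      every one extends to a field.\<close>
    have "v h = 0" if "v \<in> T p" "h \<in> C" for v h
      using False vector_extension[OF that(1)] that(2) by blast
    then have "pb f g p = 0" "pb g f p = 0" using pb_T f g by blast+
    then show ?thesis by simp
  qed
qed

text \<open>Each derivation {h, .} at p is the multiple {h, x b} of the single frame vector.
  Skewness gives {x b, x b} = 0, hence {x b, f} = 0; swapping the arguments gives {f, x b} =
  0.\<close>

lemma anchor_zero_dim1:
  assumes dim: "dim (UNIV :: 'e set) = 1" and f: "f \<in> C" and g: "g \<in> C"
  shows "pb f g p = 0"
proof -
  obtain B \<eta> x E where fr: "frame_at p B \<eta> x E" using frame_exists by blast
  obtain b where B: "B = {b}" using fr dim by (auto simp: frame_at_def card_1_singleton_iff)
  have x: "x b \<in> C" and E: "E b p \<in> T p" using fr by (simp_all add: frame_at_def vf_T)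
  have r: "pb h k p = pb h (x b) p * E b p k" if "h \<in> C" for h k
    using fun_cong[OF frame_vector_at[OF fr pb_T[OF that]], of k] by (simp add: B)
  have "pb (x b) (x b) p = 0" using pb_skew[OF x x, of p] by simp
  then have "pb (x b) f p = 0" using r[OF x, of f] by simp
  then have "pb f (x b) p = 0" using pb_skew[OF f x, of p] by simp
  then show ?thesis using r[OF f, of g] by simp
qed

lemma br_exact:
  assumes f: "f \<in> C" and g: "g \<in> C" and X: "X \<in> VF"
  shows "br (d f) (d g) p (X p) = X p (pb f g)"
proof (cases "dim (UNIV :: 'e set) = 1")
  case False
  have "pb g (\<lambda>q. X q f) p = - pb (\<lambda>q. X q f) g p" by (rule pb_skew[OF g vf_fun[OF X f]])
  then show ?thesis using defect_zero[OF False X g f, of p] by (simp add: defect_def)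
next
  case True
  obtain B \<eta> x E where fr: "frame_at p B \<eta> x E" using frame_exists by blast
  obtain b where B: "B = {b}" using fr True by (auto simp: frame_at_def card_1_singleton_iff)
  have x: "x b \<in> C" using fr by (simp add: frame_at_def)
  have anchor0: "\<rho> p (\<alpha> p) u = 0" if \<alpha>: "\<alpha> \<in> Om" and u: "u \<in> C" for \<alpha> u p
  proof -
    obtain h where "h \<in> C" "\<alpha> p = d h p" using covector_exact[OF form_cov[OF \<alpha>]] by blast
    then show ?thesis using anchor_zero_dim1[OF True _ u] by (simp add: pb_def)
  qed
  \<comment> \<open>With the anchor zero, the derivative terms of the Leibniz rule drop out, so the
    bracket is function-linear in its second slot.\<close>
  have expand: "br \<alpha> \<beta> p (X p) = \<beta> p (E b p) * br \<alpha> (d (x b)) p (X p)"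
    if \<alpha>: "\<alpha> \<in> Om" and \<beta>: "\<beta> \<in> Om" for \<alpha> \<beta>
  proof -
    have "br \<alpha> \<beta> p (X p) = (\<Sum>b\<in>B. \<beta> p (E b p) * br \<alpha> (d (x b)) p (X p))"
      by (rule tensorial_expand[OF fr _ \<beta>, where \<Phi> = "\<lambda>\<beta>. br \<alpha> \<beta> p (X p)"])
        (simp add: br_combination_right \<alpha> anchor0)
    then show ?thesis by (simp add: B)
  qed
  note dx = d_form[OF x] and df = d_form[OF f] and dg = d_form[OF g]
  have sk: "br \<alpha> \<beta> p v = - br \<beta> \<alpha> p v" if "\<alpha> \<in> Om" "\<beta> \<in> Om" for \<alpha> \<beta> v
    using br_skew[OF that] by simp
  have "br (d (x b)) (d (x b)) p (X p) = 0" using sk[OF dx dx, of "X p"] by simp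
  then have "br (d (x b)) (d f) p (X p) = 0" using expand[OF dx df] by simp
  then have "br (d f) (d (x b)) p (X p) = 0" using sk[OF df dx, of "X p"] by simp
  then have "br (d f) (d g) p (X p) = 0" using expand[OF df dg] by simp
  moreover have "pb f g = (\<lambda>_. 0)" using anchor_zero_dim1[OF True f g] by (rule ext)
  ultimately show ?thesis by (simp add: tv_const[OF vf_T[OF X]])
qed

section \<open>Comparison with the bracket of 1-forms defined by the bivector\<close>

abbreviation ham :: "('a \<Rightarrow> 'a covec) \<Rightarrow> 'a \<Rightarrow> 'a tvec" where
  "ham \<alpha> p \<equiv> \<rho> p (\<alpha> p)"

lemma anchor_skew:
  assumes \<alpha>: "\<alpha> \<in> Om" and \<beta>: "\<beta> \<in> Om"
  shows "\<alpha> p (ham \<beta> p) = - \<beta> p (ham \<alpha> p)"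
proof -
  obtain h k where h: "h \<in> C" "\<alpha> p = d h p" and k: "k \<in> C" "\<beta> p = d k p"
    using covector_exact[OF form_cov[OF \<alpha>]] covector_exact[OF form_cov[OF \<beta>]] by blast
  show ?thesis
    using pb_skew[OF h(1) k(1), of p] anchor_T[OF d_cov[OF h(1)]] anchor_T[OF d_cov[OF k(1)]]
    by (simp add: h k d_apply pb_def)
qed

text \<open>The bracket $[\alpha,\beta]_\pi$ paired with the vector field \<^term>\<open>Y\<close>.\<close>

definition koszul :: "('a \<Rightarrow> 'a covec) \<Rightarrow> ('a \<Rightarrow> 'a covec) \<Rightarrow> ('a \<Rightarrow> 'a tvec) \<Rightarrow> 'a \<Rightarrow> real" where
  "koszul \<alpha> \<beta> Y p =
     (ham \<alpha> p (\<lambda>q. \<beta> q (Y q)) - \<beta> p (lie_bracket (ham \<alpha>) Y p))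
     - (ham \<beta> p (\<lambda>q. \<alpha> q (Y q)) - \<alpha> p (lie_bracket (ham \<beta>) Y p))
     - Y p (\<lambda>q. \<beta> q (ham \<alpha> q))"

lemma koszul_skew:
  assumes \<alpha>: "\<alpha> \<in> Om" and \<beta>: "\<beta> \<in> Om" and Y: "Y \<in> VF"
  shows "koszul \<alpha> \<beta> Y p = - koszul \<beta> \<alpha> Y p"
proof -
  have "(\<lambda>q. \<alpha> q (ham \<beta> q)) = (\<lambda>q. - \<beta> q (ham \<alpha> q))"
    using anchor_skew[OF \<alpha> \<beta>] by (rule ext)
  then have "Y p (\<lambda>q. \<alpha> q (ham \<beta> q)) = - Y p (\<lambda>q. \<beta> q (ham \<alpha> q))"
    using tv_uminus[OF vf_T[OF Y] form_fun[OF \<beta> anchor_VF[OF \<alpha>]]] by simp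
  then show ?thesis by (simp add: koszul_def)
qed

text \<open>The same rule as \<open>br_combination_right\<close>. The bracket of u
  \<open>ham\<close> \<beta> with Y contributes -Y(u) \<alpha>(\<open>ham\<close> \<beta>), the
  final differential -Y(u) \<beta>(\<open>ham\<close> \<alpha>); \<open>anchor_skew\<close> makes
  them cancel.\<close>

lemma koszul_combination:
  assumes \<alpha>: "\<alpha> \<in> Om" and \<beta>: "\<beta> \<in> Om" and \<gamma>: "\<gamma> \<in> Om" and Y: "Y \<in> VF"
    and u: "u \<in> C" and w: "w \<in> C"
  shows "koszul \<alpha> (\<lambda>q v. u q * \<beta> q v + w q * \<gamma> q v) Y p =
    u p * koszul \<alpha> \<beta> Y p + ham \<alpha> p u * \<beta> p (Y p) + (w p * koszul \<alpha> \<gamma> Y p + ham \<alpha> p w * \<gamma> p (Y p))"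
proof -
  let ?\<theta> = "\<lambda>q v. u q * \<beta> q v + w q * \<gamma> q v"
  have Ha: "ham \<alpha> \<in> VF" and Hb: "ham \<beta> \<in> VF" and Hc: "ham \<gamma> \<in> VF"
    using anchor_VF \<alpha> \<beta> \<gamma> by auto
  note fb = form_fun[OF \<beta>] and fc = form_fun[OF \<gamma>]
  have H: "ham ?\<theta> q = (\<lambda>f. u q * ham \<beta> q f + w q * ham \<gamma> q f)" for q
    by (rule anchor_lin[OF form_cov[OF \<beta>] form_cov[OF \<gamma>]])
  have 1: "ham \<alpha> p (\<lambda>q. ?\<theta> q (Y q)) =
      u p * ham \<alpha> p (\<lambda>q. \<beta> q (Y q)) + ham \<alpha> p u * \<beta> p (Y p)
      + (w p * ham \<alpha> p (\<lambda>q. \<gamma> q (Y q)) + ham \<alpha> p w * \<gamma> p (Y p))"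
    using fb[OF Y] fc[OF Y] u w
    by (simp add: tv_add[OF vf_T[OF Ha]] tv_mult[OF vf_T[OF Ha]] smooth_fun_mult)
  have 2: "ham ?\<theta> p (\<lambda>q. \<alpha> q (Y q)) = u p * ham \<beta> p (\<lambda>q. \<alpha> q (Y q)) + w p * ham \<gamma> p (\<lambda>q. \<alpha> q (Y q))"
    by (simp add: H)
  have 3: "lie_bracket (ham ?\<theta>) Y p =
      (\<lambda>f. u p * lie_bracket (ham \<beta>) Y p f + (- Y p u) * ham \<beta> p f +
        (w p * lie_bracket (ham \<gamma>) Y p f + (- Y p w) * ham \<gamma> p f))"
  proof -
    note b = vf_scale[OF Hb u] and c = vf_scale[OF Hc w]
    have "lie_bracket (ham ?\<theta>) Y p f = lie_bracket (\<lambda>q f. u q * ham \<beta> q f) Y p f + lie_bracket (\<lambda>q f. w q * ham \<gamma> q f) Y p f"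
      for f
    proof (cases "f \<in> C")
      case True
      show ?thesis
        unfolding H lie_bracket_def
        by (subst tv_add[OF vf_T[OF Y] vf_fun[OF b True] vf_fun[OF c True]]) simp
    next
      case False
      then show ?thesis
        unfolding lie_bracket_def H
        by (simp add: tv_outside[OF vf_T[OF Hb]] tv_outside[OF vf_T[OF Hc]] tv_outside[OF vf_T[OF Y]]
            tv_const[OF vf_T[OF Hb]] tv_const[OF vf_T[OF Hc]] tv_const[OF vf_T[OF Y]])
    qed
    then show ?thesis
      unfolding lie_bracket_scale_left[OF Hb Y u] lie_bracket_scale_left[OF Hc Y w] by (rule ext)
  qed
  have T1: "lie_bracket (ham \<beta>) Y p \<in> T p" and T2: "lie_bracket (ham \<gamma>) Y p \<in> T p"
    and T3: "ham \<beta> p \<in> T p" and T4: "ham \<gamma> p \<in> T p"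
    using vf_T vf_lie_bracket Y Hb Hc by auto
  have 4: "\<alpha> p (lie_bracket (ham ?\<theta>) Y p) =
      u p * \<alpha> p (lie_bracket (ham \<beta>) Y p) + (- Y p u) * \<alpha> p (ham \<beta> p) +
      (w p * \<alpha> p (lie_bracket (ham \<gamma>) Y p) + (- Y p w) * \<alpha> p (ham \<gamma> p))"
    unfolding 3
    using cov_lin[OF form_cov[OF \<alpha>] tv_combination[OF T1 T3, of "u p" "- Y p u"]
        tv_combination[OF T2 T4, of "w p" "- Y p w"], of 1 1]
      cov_lin[OF form_cov[OF \<alpha>] T1 T3, of "u p" "- Y p u"]
      cov_lin[OF form_cov[OF \<alpha>] T2 T4, of "w p" "- Y p w"] by simp
  have 5: "Y p (\<lambda>q. ?\<theta> q (ham \<alpha> q)) =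
      u p * Y p (\<lambda>q. \<beta> q (ham \<alpha> q)) + Y p u * \<beta> p (ham \<alpha> p)
      + (w p * Y p (\<lambda>q. \<gamma> q (ham \<alpha> q)) + Y p w * \<gamma> p (ham \<alpha> p))"
    using fb[OF Ha] fc[OF Ha] u w
    by (simp add: tv_add[OF vf_T[OF Y]] tv_mult[OF vf_T[OF Y]] smooth_fun_mult)
  show ?thesis
    unfolding koszul_def 1 2 4 5 anchor_skew[OF \<alpha> \<beta>] anchor_skew[OF \<alpha> \<gamma>]
    by (simp add: algebra_simps)
qed

text \<open>The first Lie derivative collapses to Y{f,g}, the second, subtracted, to -Y{g,f} =
  Y{f,g}, and the last term is -Y{f,g}.\<close>

lemma koszul_exact:
  assumes f: "f \<in> C" and g: "g \<in> C" and Y: "Y \<in> VF"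
  shows "koszul (d f) (d g) Y p = Y p (pb f g)"
proof -
  have e: "d h p (X p) = X p h" if "X \<in> VF" for h X p by (rule d_apply[OF vf_T[OF that]])
  have F: "ham (d f) \<in> VF" and G: "ham (d g) \<in> VF" using anchor_VF d_form f g by auto
  have "(\<lambda>q. ham (d g) q f) = (\<lambda>q. - ham (d f) q g)"
    using pb_skew[OF g f] unfolding pb_def by (rule ext)
  then have "Y p (\<lambda>q. ham (d g) q f) = - Y p (\<lambda>q. ham (d f) q g)"
    using tv_uminus[OF vf_T[OF Y] pb_fun[OF f g]] by (simp add: pb_def[abs_def])
  then show ?thesis
    by (simp add: koszul_def e[OF Y] e[OF F] e[OF vf_lie_bracket[OF F Y]] e[OF vf_lie_bracket[OF G Y]]
        lie_bracket_def pb_def[abs_def])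
qed

lemma br_eq_koszul:
  assumes \<alpha>: "\<alpha> \<in> Om" and \<beta>: "\<beta> \<in> Om" and Y: "Y \<in> VF"
  shows "br \<alpha> \<beta> p (Y p) = koszul \<alpha> \<beta> Y p"
proof -
  obtain B \<eta> x E where fr: "frame_at p B \<eta> x E" using frame_exists by blast
  have x: "x b \<in> C" for b using fr by (simp add: frame_at_def)
  define \<Delta> where "\<Delta> \<alpha> \<beta> = br \<alpha> \<beta> p (Y p) - koszul \<alpha> \<beta> Y p" for \<alpha> \<beta>
  have expand: "\<Delta> \<alpha> \<beta> = (\<Sum>b\<in>B. \<beta> p (E b p) * \<Delta> \<alpha> (d (x b)))" if \<alpha>: "\<alpha> \<in> Om" and \<beta>: "\<beta> \<in> Om" for \<alpha> \<beta>
    by (rule tensorial_expand[OF fr _ \<beta>])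
      (simp add: \<Delta>_def br_combination_right koszul_combination \<alpha> Y algebra_simps)
  have skew: "\<Delta> \<alpha> \<beta> = - \<Delta> \<beta> \<alpha>" if "\<alpha> \<in> Om" "\<beta> \<in> Om" for \<alpha> \<beta>
    unfolding \<Delta>_def koszul_skew[OF that Y] br_skew[OF that] by simp
  have exact: "\<Delta> (d f) (d g) = 0" if "f \<in> C" "g \<in> C" for f g
    by (simp add: \<Delta>_def br_exact[OF that Y] koszul_exact[OF that Y])
  \<comment> \<open>Expansion is available in the second slot only, so the first slot is reached by
    skewness and a second expansion.\<close>
  have "\<Delta> (d f) \<gamma> = 0" if "f \<in> C" "\<gamma> \<in> Om" for f \<gamma>
    using expand[OF d_form[OF that(1)] that(2)] exact[OF that(1) x] by simp
  then have "\<Delta> \<alpha> (d (x b)) = 0" for b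
    using skew[OF \<alpha> d_form[OF x[of b]]] x \<alpha> by simp
  then have "\<Delta> \<alpha> \<beta> = 0" using expand[OF \<alpha> \<beta>] by simp
  then show ?thesis by (simp add: \<Delta>_def)
qed


section \<open>The Poisson structure\<close>

text \<open>The bivector of the bracket of functions, with the extension by 0 that
  \<open>multivector_fields\<close> prescribes.\<close>

definition poisson :: "'a \<Rightarrow> 'a mvec" where
  "poisson p fs = (if length fs = 2 \<and> set fs \<subseteq> C then pb (fs ! 0) (fs ! 1) p else 0)"

lemma poisson_apply: "f \<in> C \<Longrightarrow> g \<in> C \<Longrightarrow> poisson p [f, g] = pb f g p"
  and poisson_outside: "\<not> (f \<in> C \<and> g \<in> C) \<Longrightarrow> poisson p [f, g] = 0"
  by (auto simp: poisson_def)

lemma poisson_skew: "poisson p [f, g] = - poisson p [g, f]"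
  by (cases "f \<in> C \<and> g \<in> C") (auto simp: poisson_apply poisson_outside intro: pb_skew)

lemma poisson_T: "(\<lambda>g. poisson p [f, g]) \<in> T p"
proof (cases "f \<in> C")
  case True
  have "poisson p [f, g] = pb f g p" for g
    using True tv_outside[OF pb_T[OF True]] by (cases "g \<in> C") (simp_all add: poisson_apply poisson_outside)
  then show ?thesis using pb_T[OF True] by simp
qed (simp add: poisson_outside tv_zero)

lemma poisson_multivector: "poisson \<in> multivector_fields A 2"
proof -
  have left: "(\<lambda>f. poisson p [f, g]) \<in> T p" for p g
    using tv_combination[OF poisson_T[of p g] poisson_T[of p g], of "- 1" 0]
    by (simp add: poisson_skew[of p _ g])
  have "poisson p \<in> multitangent_space A 2 p" for p
    unfolding multitangent_space_def mem_Collect_eq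
  proof (intro conjI allI impI)
    fix fs :: "('a \<Rightarrow> real) list" and i :: nat
    assume fs: "length fs = 2 \<and> set fs \<subseteq> C" and i: "i < 2"
    obtain f g where fg: "fs = [f, g]" using fs by (auto simp: length_Suc_conv numeral_2_eq_2)
    show "(\<lambda>f. poisson p (fs[i := f])) \<in> T p"
      using i poisson_T[of p f] left[of p g] unfolding fg by (auto simp: less_2_cases_iff)
    fix j :: nat assume j: "j < 2" "i \<noteq> j \<and> fs ! i = fs ! j"
    then have "f = g" using i unfolding fg by (auto simp: less_2_cases_iff)
    then show "poisson p fs = 0" using poisson_skew[of p f f] unfolding fg by simp
  qed (auto simp: poisson_def)
  moreover have "(\<lambda>p. poisson p fs) \<in> C" if fs: "length fs = 2 \<and> set fs \<subseteq> C" for fs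
  proof -
    obtain f g where fg: "fs = [f, g]" using fs by (auto simp: length_Suc_conv numeral_2_eq_2)
    then have "(\<lambda>p. poisson p fs) = pb f g" using fs by (auto simp: poisson_apply)
    then show ?thesis using fs fg by (simp add: pb_fun)
  qed
  ultimately show ?thesis by (simp add: multivector_fields_def)
qed

text \<open>As [df, dg]_* = d{f,g}, compatibility of the anchor with brackets says that {{f,g},h} is
  the commutator of {f, .} and {g, .} applied to h.\<close>

lemma pb_Jacobi:
  assumes f: "f \<in> C" and g: "g \<in> C" and h: "h \<in> C"
  shows "pb f (pb g h) p + pb g (pb h f) p + pb h (pb f g) p = 0"
proof -
  have "br (d f) (d g) p = d (pb f g) p"
  proof
    fix v
    show "br (d f) (d g) p v = d (pb f g) p v"
    proof (cases "v \<in> T p")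
      case True
      then obtain Y where "Y \<in> VF" "Y p = v" using vector_extension by blast
      then show ?thesis using br_exact[OF f g, of Y p] True by (simp add: d_apply)
    next
      case False
      then show ?thesis
        using cov_outside[OF form_cov[OF br_form[OF d_form[OF f] d_form[OF g]]]]
        by (simp add: differential_def)
    qed
  qed
  then have "pb (pb f g) h p = lie_bracket (ham (d f)) (ham (d g)) p h"
    using fun_cong[OF fun_cong[OF br_anchor[OF d_form[OF f] d_form[OF g]]], of p h] by (simp add: pb_def)
  then have "pb (pb f g) h p = pb f (pb g h) p - pb g (pb f h) p"
    by (simp add: lie_bracket_def pb_def[abs_def])
  moreover have "pb (pb f g) h p = - pb h (pb f g) p" by (rule pb_skew[OF pb_fun[OF f g] h])
  moreover have "pb f h = (\<lambda>q. - pb h f q)" using pb_skew[OF f h] by (rule ext)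
  then have "pb g (pb f h) p = - pb g (pb h f) p" using tv_uminus[OF pb_T[OF g] pb_fun[OF h f]] by simp
  ultimately show ?thesis by simp
qed

text \<open>\<open>schouten 2 2\<close> of the bivector with itself consists of multiples of
  \<open>mv_insert 2 2\<close>, which skewness turns into the Jacobiator. Arguments that are not
  smooth are treated separately: each term is then 0.\<close>

lemma poisson_poisson: "poisson_structure A poisson"
proof -
  let ?J = "\<lambda>p f g h. poisson p [f, \<lambda>q. poisson q [g, h]]"
  have sk: "?J p f h g = - ?J p f g h" for p f g h
  proof -
    have "(\<lambda>q. poisson q [h, g]) = (\<lambda>q. - 1 * poisson q [g, h])"
      by (rule ext) (subst poisson_skew, simp)
    moreover have "(\<lambda>q. poisson q [g, h]) \<in> C"
      by (cases "g \<in> C \<and> h \<in> C") (simp_all add: poisson_apply poisson_outside pb_fun smooth_fun_const)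
    ultimately show ?thesis using tv_cmult[OF poisson_T[of p f], of _ "- 1"] by simp
  qed
  have J: "?J p f g h + ?J p g h f + ?J p h f g = 0" for p f g h
  proof (cases "f \<in> C \<and> g \<in> C \<and> h \<in> C")
    case True
    have e: "?J p f g h = pb f (pb g h) p" if "f \<in> C" "g \<in> C" "h \<in> C" for f g h
      using that by (simp add: poisson_apply pb_fun)
    show ?thesis using pb_Jacobi True by (simp add: e)
  next
    case False
    have z: "?J p f g h = 0" if "\<not> (f \<in> C \<and> g \<in> C \<and> h \<in> C)" for f g h
    proof (cases "f \<in> C")
      case True
      with that have "(\<lambda>q. poisson q [g, h]) = (\<lambda>q. 0)" by (auto simp: poisson_outside)
      then show ?thesis by (simp add: tv_const[OF poisson_T])
    qed (simp add: poisson_outside)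
    show ?thesis using z[of f g h] z[of g h f] z[of h f g] False by auto
  qed
  have "schouten 2 2 poisson poisson p fs = 0" for p fs
  proof (cases "length fs = 3")
    case True
    then obtain f g h where "fs = [f, g, h]" by (auto simp: length_Suc_conv numeral_3_eq_3)
    moreover have "mv_insert 2 2 poisson poisson p [f, g, h] = 0"
    proof -
      have "(a - a' + b - b' + c - c') / 2 = 0" if "a + b + c = 0" "a' = - a" "b' = - b" "c' = - c"
        for a a' b b' c c' :: real
        using that by simp
      from this[OF J sk sk sk] show ?thesis unfolding mv_insert_2_2 .
    qed
    ultimately show ?thesis by (simp add: schouten_def)
  qed (simp add: schouten_def)
  then show ?thesis using poisson_multivector by (simp add: poisson_structure_def fun_eq_iff)
qed

text \<open>Writing \<omega> as d h at p turns both sides into the bracket of h and g at p.\<close>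

lemma anchor_eq_sharp:
  assumes \<omega>: "\<omega> \<in> Tc p"
  shows "\<rho> p \<omega> = sharp poisson p \<omega>"
proof
  fix g
  obtain h where h: "h \<in> C" "\<omega> = d h p" using covector_exact[OF \<omega>] by blast
  have "(\<lambda>f. poisson p [f, g]) \<in> T p"
    using tv_combination[OF poisson_T[of p g] poisson_T[of p g], of "- 1" 0]
    by (simp add: poisson_skew[of p _ g])
  then have "sharp poisson p \<omega> g = poisson p [h, g]" by (simp add: sharp_def h d_apply)
  also have "\<dots> = \<rho> p \<omega> g"
    using h tv_outside[OF pb_T[OF h(1)]]
    by (cases "g \<in> C") (simp_all add: poisson_apply poisson_outside pb_def)
  finally show "\<rho> p \<omega> g = sharp poisson p \<omega> g" by simp
qed

lemma br_eq_poisson_bracket: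
  assumes \<alpha>: "\<alpha> \<in> Om" and \<beta>: "\<beta> \<in> Om"
  shows "br \<alpha> \<beta> = poisson_bracket A poisson \<alpha> \<beta>"
proof (intro ext)
  fix p v
  have s: "sharp poisson q (\<gamma> q) = ham \<gamma> q" if "\<gamma> \<in> Om" for \<gamma> q
    using anchor_eq_sharp[OF form_cov[OF that]] by simp
  show "br \<alpha> \<beta> p v = poisson_bracket A poisson \<alpha> \<beta> p v"
  proof (cases "v \<in> T p")
    case True
    \<comment> \<open>This is the extension chosen inside \<open>lie_derivative\<close>, the same
      one for both Lie derivatives. As \<open>br_eq_koszul\<close> holds for every Y, the choice
      does no harm.\<close>
    define Y where "Y = (SOME Y. Y \<in> VF \<and> Y p = v)"
    have "Y \<in> VF \<and> Y p = v"
      unfolding Y_def using someI_ex[OF vector_extension[OF True, unfolded Bex_def]] .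
    then have Y: "Y \<in> VF" "Y p = v" by auto
    have "poisson_bracket A poisson \<alpha> \<beta> p v = koszul \<alpha> \<beta> Y p"
      unfolding poisson_bracket_def lie_derivative_def Y_def[symmetric] Let_def koszul_def s[OF \<alpha>] s[OF \<beta>]
      using True Y(2) by (simp add: d_apply)
    then show ?thesis using br_eq_koszul[OF \<alpha> \<beta> Y(1), of p] Y(2) by simp
  next
    case False
    then show ?thesis
      using cov_outside[OF form_cov[OF br_form[OF \<alpha> \<beta>]] False]
      by (simp add: poisson_bracket_def lie_derivative_def differential_def)
  qed
qed

end

theorem corollary5p3:
  fixes A :: "('a::{t2_space,second_countable_topology}, 'e::{real_inner,banach}) atlas"
    and br :: "('a \<Rightarrow> 'a covec) \<Rightarrow> ('a \<Rightarrow> 'a covec) \<Rightarrow> ('a \<Rightarrow> 'a covec)"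
    and \<rho> :: "'a \<Rightarrow> 'a covec \<Rightarrow> 'a tvec"
  assumes "smooth_manifold A"
    and "lie_bialgebroid A br \<rho>"
    and "dim (UNIV :: 'e set) = 1 \<Longrightarrow> compatible_on_functions A br \<rho>"
  shows "\<exists>\<pi>. poisson_structure A \<pi> \<and> comes_from_poisson A br \<rho> \<pi>"
proof -
  interpret bialgebroid A br \<rho>
  proof unfold_locales
    show "cotangent_lie_algebroid A br \<rho>" using assms(2) by (simp add: lie_bialgebroid_def)
  qed (use assms in auto)
  have "comes_from_poisson A br \<rho> poisson"
    unfolding comes_from_poisson_def using anchor_eq_sharp br_eq_poisson_bracket by blast
  with poisson_poisson show ?thesis by blast
qed

end
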